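(* Let $d_u,d_w$ be fixed positive integers. Let $G=(U\cup W,E)$ be a random bi-regular bipartite graph, i.e. chosen uniformly at random among all bipartite graphs (without parallel edges) on fixed labelled parts $U,W$ with $|U|d_u=|W|d_w$ in which every node of $U$ has degree $d_u$ and every node of $W$ has degree $d_w$. For even $c$, let $N_c(G)$ be the number of cycles of length $c$ in $G$. Then, as the number of nodes tends to infinity, for any fixed even $k\ge4$ the random variables $N_4(G),N_6(G),\dots,N_k(G)$ are asymptotically independent with Poisson distributions (the random vector converges in distribution to a vector of independent Poisson random variables), where for each even $4\le c\le k$ the expected value of $N_c$ satisfies $$E(N_c)\;\longrightarrow\;\frac{\big((d_u-1)(d_w-1)\big)^{c/2}}{c},$$ and this limit is the mean of the limiting Poisson variable for $N_c$.
   Context: A cycle of length $c$ in a graph is a closed path with $c$ distinct nodes, identified with its set of $c$ edges (so it is counted once, regardless of starting node and direction). *)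

theory Defs
  imports "HOL-Probability.Probability"
begin

(* An undirected graph without loops or parallel edges is represented by its edge set,
   a set of two-element sets of nodes. *)

definition node_degree :: "'a set set \<Rightarrow> 'a \<Rightarrow> nat" where
  "node_degree E v = card {e \<in> E. v \<in> e}"

definition biregular_bipartite_graphs ::
    "'a set \<Rightarrow> 'a set \<Rightarrow> nat \<Rightarrow> nat \<Rightarrow> 'a set set set" where
  "biregular_bipartite_graphs U W du dw =
     {E. E \<subseteq> {{u, w} | u w. u \<in> U \<and> w \<in> W} \<and>
         (\<forall>u\<in>U. node_degree E u = du) \<and> (\<forall>w\<in>W. node_degree E w = dw)}"

(* Uniform distribution. It is meaningful only when such a graph exists: pmf_of_set of the
   empty set is unspecified. *)
definition random_biregular_bipartite_graph ::
    "'a set \<Rightarrow> 'a set \<Rightarrow> nat \<Rightarrow> nat \<Rightarrow> 'a set set pmf" where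
  "random_biregular_bipartite_graph U W du dw =
     pmf_of_set (biregular_bipartite_graphs U W du dw)"

definition closed_path_edges :: "'a list \<Rightarrow> 'a set set" where
  "closed_path_edges p = {{p ! i, p ! (Suc i mod length p)} | i. i < length p}"

(* Cycles are edge sets, so the starting node and the direction of the path are forgotten.
   The bound 3 excludes paths traversing a single edge back and forth. *)
definition cycles :: "nat \<Rightarrow> 'a set set \<Rightarrow> 'a set set set" where
  "cycles c E = {closed_path_edges p | p.
     length p = c \<and> 3 \<le> c \<and> distinct p \<and> closed_path_edges p \<subseteq> E}"

definition num_cycles :: "nat \<Rightarrow> 'a set set \<Rightarrow> nat" where
  "num_cycles c E = card (cycles c E)"

(* poisson_pmf is specified only for positive rates; the Poisson distribution with mean 0
   is the point mass at 0. *)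
definition poisson_distribution :: "real \<Rightarrow> nat pmf" where
  "poisson_distribution r = (if r = 0 then return_pmf 0 else poisson_pmf r)"

definition converges_in_distribution ::
    "(nat \<Rightarrow> 'a::topological_space pmf) \<Rightarrow> 'a pmf \<Rightarrow> bool" where
  "converges_in_distribution P Q \<longleftrightarrow>
     (\<forall>f :: 'a \<Rightarrow> real. continuous_on UNIV f \<and> bounded (range f) \<longrightarrow>
        (\<lambda>n. measure_pmf.expectation (P n) f) \<longlonglongrightarrow> measure_pmf.expectation Q f)"

definition cycle_lengths :: "nat \<Rightarrow> nat set" where
  "cycle_lengths k = {c. even c \<and> 4 \<le> c \<and> c \<le> k}"

(* A real vector indexed by a finite set of lengths is a function that is 0 off that set;
   this is the encoding of Pi_pmf with default value 0, and the product topology on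
   functions restricts to the Euclidean one on such vectors. *)
definition cycle_vector :: "nat \<Rightarrow> 'a set set \<Rightarrow> nat \<Rightarrow> real" where
  "cycle_vector k E = (\<lambda>c. if c \<in> cycle_lengths k then real (num_cycles c E) else 0)"

definition cycle_mean :: "nat \<Rightarrow> nat \<Rightarrow> nat \<Rightarrow> real" where
  "cycle_mean du dw c = ((real du - 1) * (real dw - 1)) ^ (c div 2) / real c"

end

theory Submission
  imports Defs
begin

text \<open>Let a graph contain a cycle \<open>s, \<dots>, t\<close> of length \<open>c\<close> with closing edge \<open>{t, s}\<close>, and let \<open>{a, b}\<close>
  be another edge. Replacing these two edges by \<open>{a, s}\<close> and \<open>{t, b}\<close> turns the cycle into a path
  \<open>a, s, \<dots>, t, b\<close> with \<open>c + 1\<close> edges, and conversely. With \<open>m\<close> edges, there are \<open>c m\<close> choices of the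
  closing edge and the other edge for each cycle, whereas every biregular graph has exactly
  \<open>m ((du - 1) (dw - 1))^(c/2)\<close> nonbacktracking walks of this length ending in \<open>U\<close>. Hence:
  \<^item> all but \<open>O(1)\<close> of the edges \<open>{a, b}\<close> can be used, so \<open>E N_c \<le> cycle_mean c + O(1/m)\<close>;
  \<^item> all walks can be used except the ones starting near a short cycle, on average \<open>O(1)\<close> in number
    by the first bound. Switching at such a walk creates exactly one short cycle, so
    \<open>cycle_mean c * P(N = x) \<le> (x c + 1) P(N = x + 1_c) + O(1/m)\<close>.

  Summing the second inequality over all \<open>x\<close> and comparing with the first one shows that it is
  asymptotically an equality, and this recursion together with tightness determines the limit.\<close>

section \<open>Walks and cycles\<close>

text \<open>The two directions of the switching carry different information. Opening a cycle may
  destroy or create other short cycles, so it only bounds a mean. Closing a walk that stays away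
  from short cycles raises the vector of counts by one unit in one coordinate, because short paths
  from the start of such a walk are unique. So only first moments are estimated, never joint or
  higher moments.

  The sum over all \<open>x\<close> cannot be taken literally: an error O(1/m) at each of infinitely
  many points has no finite total. It is cut off at a finite box, Markov's inequality bounds the
  mass outside, and \<open>m\<close> tends to infinity for a fixed box before the box grows.

  The radius \<open>2 * k + 2\<close> is the largest number of nodes that two competing paths have
  together in the uniqueness argument. It exceeds \<open>k\<close>, so the means of cycle counts
  beyond length \<open>k\<close> must be bounded too.\<close>

abbreviation walk :: "'a set set \<Rightarrow> 'a list \<Rightarrow> bool" where
  "walk E p \<equiv> successively (\<lambda>a b. {a, b} \<in> E) p"

fun nonbacktracking :: "'a list \<Rightarrow> bool" where
  "nonbacktracking (x # y # z # p) \<longleftrightarrow> x \<noteq> z \<and> nonbacktracking (y # z # p)"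
| "nonbacktracking _ \<longleftrightarrow> True"

lemma walk_rev [simp]: "walk E (rev p) \<longleftrightarrow> walk E p"
  by (simp add: insert_commute)

declare successively_rev [simp del]

lemma nonbacktracking_if_distinct: "distinct p \<Longrightarrow> nonbacktracking p"
  by (induction p rule: nonbacktracking.induct) auto

text \<open>Two paths are glued at \<open>y\<close>; only the turn at \<open>y\<close> could
  backtrack, and the last premise excludes this.\<close>

lemma nonbacktracking_join:
  assumes "distinct (xs @ [y])" "distinct (y # zs)"
    and "xs \<noteq> [] \<Longrightarrow> zs \<noteq> [] \<Longrightarrow> last xs \<noteq> hd zs"
  shows "nonbacktracking (xs @ y # zs)"
  using assms
proof (induction xs)
  case Nil
  then show ?case by (simp add: nonbacktracking_if_distinct)
next
  case (Cons x xs)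
  have IH: "nonbacktracking (xs @ y # zs)"
    using Cons by (cases xs) (auto simp: nonbacktracking_if_distinct)
  show ?case
  proof (cases xs)
    case Nil
    then show ?thesis using Cons.prems IH by (cases zs) auto
  next
    case (Cons x' xs')
    then show ?thesis using Cons.prems IH by (cases xs') auto
  qed
qed

section \<open>Closed paths as edge sets\<close>

lemma closed_path_edges_conv:
  assumes "p \<noteq> []"
  shows "closed_path_edges p =
    insert {last p, hd p} {{p ! i, p ! Suc i} | i. Suc i < length p}"
proof -
  have "\<exists>i<length p. {last p, hd p} = {p ! i, p ! (Suc i mod length p)}"
    using assms by (intro exI[of _ "length p - 1"]) (auto simp: last_conv_nth hd_conv_nth)
  moreover have "{p ! i, p ! (Suc i mod length p)} = {last p, hd p} \<or>
      (Suc i < length p \<and> {p ! i, p ! (Suc i mod length p)} = {p ! i, p ! Suc i})"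
    if "i < length p" for i
  proof (cases "Suc i = length p")
    case True
    then have "i = length p - 1" by simp
    then show ?thesis using assms True by (simp add: last_conv_nth hd_conv_nth)
  qed (use that in simp)
  moreover have "\<exists>j<length p. {p ! i, p ! Suc i} = {p ! j, p ! (Suc j mod length p)}"
    if "Suc i < length p" for i
    using that by (intro exI[of _ i]) simp
  ultimately show ?thesis unfolding closed_path_edges_def
    apply (intro set_eqI iffI)
     apply (smt (verit) insert_iff mem_Collect_eq)
    apply (smt (verit) insert_iff mem_Collect_eq)
    done
qed

lemma closed_path_edges_subset_iff:
  assumes "p \<noteq> []"
  shows "closed_path_edges p \<subseteq> E \<longleftrightarrow> walk E p \<and> {last p, hd p} \<in> E"
  using assms by (auto simp: closed_path_edges_conv successively_conv_nth)

lemma Union_closed_path_edges: "\<Union>(closed_path_edges p) = set p"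
proof
  show "\<Union>(closed_path_edges p) \<subseteq> set p"
    by (auto simp: closed_path_edges_def intro!: nth_mem mod_less_divisor)
  show "set p \<subseteq> \<Union>(closed_path_edges p)"
    unfolding closed_path_edges_def set_conv_nth by blast
qed

lemma finite_closed_path_edges [simp]: "finite (closed_path_edges p)"
  by (simp add: closed_path_edges_def)

lemma closed_path_edges_rotate [simp]: "closed_path_edges (rotate k p) = closed_path_edges p"
proof (cases "p = []")
  case False
  define n where "n = length p"
  have n: "0 < n" using False by (simp add: n_def)
  \<comment> \<open>Letting the index run over all naturals modulo \<open>n\<close> turns a rotation
    into a plain shift.\<close>
  have eq: "closed_path_edges q = {{q ! (i mod n), q ! (Suc i mod n)} | i. True}"
    if "length q = n" for q :: "'a list"
  proof (intro set_eqI iffI)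
    fix e assume "e \<in> {{q ! (i mod n), q ! (Suc i mod n)} | i. True}"
    then obtain i where "e = {q ! (i mod n), q ! (Suc i mod n)}" by blast
    then show "e \<in> closed_path_edges q" unfolding closed_path_edges_def
      using n that by (intro CollectI exI[of _ "i mod n"]) (simp add: mod_Suc_eq)
  qed (use that in \<open>force simp: closed_path_edges_def\<close>)
  have rot: "rotate k p ! (i mod n) = p ! ((i + k) mod n)" for i
    using n by (subst nth_rotate) (auto simp: n_def mod_simps add.commute)
  have "{{p ! ((i + k) mod n), p ! (Suc (i + k) mod n)} | i. True} =
      {{p ! (i mod n), p ! (Suc i mod n)} | i. True}"
  proof (intro set_eqI iffI)
    fix e assume "e \<in> {{p ! (i mod n), p ! (Suc i mod n)} | i. True}"
    then obtain i where e: "e = {p ! (i mod n), p ! (Suc i mod n)}" by blast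
    \<comment> \<open>To undo the shift by \<open>k\<close> within the naturals, a multiple of
      \<open>n\<close> that is at least \<open>k\<close> is added first.\<close>
    have "k \<le> n * k" using n by simp
    then have "i + n * k - k + k = i + n * k" by linarith
    moreover have "Suc (i + n * k) mod n = Suc i mod n"
      by (metis add_Suc mod_mult_self2)
    ultimately show "e \<in> {{p ! ((i + k) mod n), p ! (Suc (i + k) mod n)} | i. True}"
      using e by (intro CollectI exI[of _ "i + n * k - k"]) simp
  qed blast
  then show ?thesis
    by (simp only: eq[of p, OF n_def[symmetric]] eq[of "rotate k p"] rot add_Suc length_rotate
        n_def[symmetric])
qed simp

lemma closed_path_edges_rev [simp]: "closed_path_edges (rev p) = closed_path_edges p"
proof -
  have sub: "{{rev p ! i, rev p ! Suc i} | i. Suc i < length p}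
      \<subseteq> {{p ! i, p ! Suc i} | i. Suc i < length p}" for p :: "'a list"
  proof clarsimp
    fix i assume "Suc i < length p"
    then show "\<exists>j. {rev p ! i, rev p ! Suc i} = {p ! j, p ! Suc j} \<and> Suc j < length p"
      by (intro exI[of _ "length p - Suc (Suc i)"]) (auto simp: rev_nth insert_commute Suc_diff_Suc)
  qed
  show ?thesis
  proof (cases "p = []")
    case False
    then show ?thesis
      using sub[of p] sub[of "rev p"]
      by (simp add: closed_path_edges_conv hd_rev last_rev insert_commute)
  qed simp
qed

text \<open>Cuts a cycle open at any of its edges, in a prescribed direction: a rotation makes this
  edge the closing one, and a reversal exchanges its ends if necessary.\<close>

lemma closed_path_edges_rerootE:
  assumes "{a, b} \<in> closed_path_edges p" "distinct p"
  obtains q where "closed_path_edges q = closed_path_edges p" "length q = length p"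
    "distinct q" "hd q = a" "last q = b"
proof -
  obtain i where i: "i < length p" "{a, b} = {p ! i, p ! (Suc i mod length p)}"
    using assms(1) by (auto simp: closed_path_edges_def)
  define q where "q = rotate (Suc i) p"
  have ne: "p \<noteq> []" using i by auto
  have q: "closed_path_edges q = closed_path_edges p" "length q = length p" "distinct q"
    unfolding q_def using assms(2) by (simp_all del: rotate_Suc)
  have hd: "hd q = p ! (Suc i mod length p)"
    using ne unfolding q_def by (simp add: hd_rotate_conv_nth del: rotate_Suc)
  have "last q = q ! (length p - 1)"
    using ne q(2) by (metis last_conv_nth length_0_conv)
  also have "\<dots> = p ! ((Suc i + (length p - 1)) mod length p)"
    using ne unfolding q_def by (subst nth_rotate) (auto simp del: rotate_Suc)
  also have "Suc i + (length p - 1) = i + length p" using ne by (cases p) auto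
  finally have last: "last q = p ! i" using i by simp
  have "q \<noteq> []" using q(2) ne by auto
  then have r: "hd (rev q) = last q" "last (rev q) = hd q" by (simp_all add: hd_rev last_rev)
  from i(2) hd last consider "hd q = a \<and> last q = b" | "hd q = b \<and> last q = a"
    by (auto simp: doubleton_eq_iff)
  then show thesis
  proof cases
    case 1
    with q show ?thesis using that by blast
  next
    case 2
    with q r show ?thesis using that[of "rev q"] by simp
  qed
qed

text \<open>Lets the length of a cycle be recovered from its edge set, and later yields the factor
  \<open>c\<close> for the choice of the closing edge. With two nodes both edges would coincide,
  hence the bound 3.\<close>

lemma card_closed_path_edges:
  assumes "distinct p" "3 \<le> length p"
  shows "card (closed_path_edges p) = length p"
proof -
  define n where "n = length p"
  have "closed_path_edges p = (\<lambda>i. {p ! i, p ! (Suc i mod n)}) ` {..<n}"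
    unfolding closed_path_edges_def n_def by auto
  moreover have "inj_on (\<lambda>i. {p ! i, p ! (Suc i mod n)}) {..<n}"
  proof (rule inj_onI)
    fix i j assume ij: "i \<in> {..<n}" "j \<in> {..<n}"
      and eq: "{p ! i, p ! (Suc i mod n)} = {p ! j, p ! (Suc j mod n)}"
    have lt: "Suc i mod n < n" "Suc j mod n < n" using ij by auto
    have inj: "p ! x = p ! y \<longleftrightarrow> x = y" if "x < n" "y < n" for x y
      using that assms(1) by (simp add: n_def nth_eq_iff_index_eq)
    show "i = j"
    proof (rule ccontr)
      assume "i \<noteq> j"
      have "p ! i = p ! j \<or> (p ! i = p ! (Suc j mod n) \<and> p ! (Suc i mod n) = p ! j)"
        using eq by (simp only: doubleton_eq_iff) blast
      then have "i = Suc j mod n" "Suc i mod n = j"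
        using ij lt \<open>i \<noteq> j\<close> by (simp_all only: inj lessThan_iff) blast+
      moreover have "Suc i mod n = (if Suc i = n then 0 else Suc i)"
        "Suc j mod n = (if Suc j = n then 0 else Suc j)" using ij by auto
      ultimately have "i = (if Suc j = n then 0 else Suc j)" "j = (if Suc i = n then 0 else Suc i)"
        by simp_all
      then show False using assms(2) unfolding n_def[symmetric]
        by (simp only: split: if_splits)
    qed
  qed
  ultimately show ?thesis by (simp add: card_image n_def)
qed

section \<open>Nonbacktracking walks and roots away from short cycles\<close>

lemma nonbacktracking_walk_contains_cycle:
  assumes "walk E p" "nonbacktracking p" "\<not> distinct p" "\<And>x. {x} \<notin> E"
  obtains p1 q p2 where "p = p1 @ q @ p2" "distinct q" "3 \<le> length q" "closed_path_edges q \<subseteq> E"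
proof -
  have "\<exists>p1 q p2. p = p1 @ q @ p2 \<and> distinct q \<and> 3 \<le> length q \<and> closed_path_edges q \<subseteq> E"
    using assms(1-3)
  proof (induction p)
    case (Cons x p)
    show ?case
    proof (cases "distinct p")
      case False
      have "walk E p" using Cons.prems by (simp add: successively_Cons) (use False in auto)
      moreover have "nonbacktracking p" using Cons.prems(2) by (cases "x # p" rule: nonbacktracking.cases) auto
      ultimately obtain p1 q p2 where "p = p1 @ q @ p2" "distinct q" "3 \<le> length q" "closed_path_edges q \<subseteq> E"
        using Cons.IH False by blast
      then show ?thesis by (intro exI[of _ "x # p1"] exI[of _ q] exI[of _ p2]) simp
    next
      case True
      \<comment> \<open>The tail is a path, so the stretch from \<open>x\<close> to its repetition
        is a closed path. It has at least three nodes, as there are neither loops nor immediate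
        returns.\<close>
      then have "x \<in> set p" using Cons.prems by simp
      then obtain q r where p: "p = q @ x # r" by (meson split_list)
      have w: "walk E (x # q @ x # r)" using Cons.prems p by simp
      have len: "q \<noteq> []" using w assms(4)[of x] by auto
      moreover have "length q \<noteq> 1" using Cons.prems(2) p by (auto simp: length_Suc_conv)
      ultimately have "3 \<le> length (x # q)" by (cases q rule: nonbacktracking.cases) auto
      moreover have "distinct (x # q)" using True p by auto
      moreover have "walk E (x # q)" "{last q, x} \<in> E"
        using w len by (auto simp: successively_Cons successively_append_iff)
      then have "closed_path_edges (x # q) \<subseteq> E"
        using len by (subst closed_path_edges_subset_iff) auto
      ultimately show ?thesis using p
        by (intro exI[of _ "[]"] exI[of _ "x # q"] exI[of _ "x # r"]) simp
    qed
  qed simp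
  then show thesis using that by blast
qed

text \<open>Local acyclicity around \<open>r\<close>, with one bound on the number of nodes for
  walks and cycles alike. Arbitrary walks are allowed, so that the exceptional roots can be counted
  by walking backwards from the short cycles.\<close>

definition tree_like :: "nat \<Rightarrow> 'a set set \<Rightarrow> 'a \<Rightarrow> bool" where
  "tree_like R E r \<longleftrightarrow> (\<forall>p q. walk E p \<longrightarrow> p \<noteq> [] \<longrightarrow> hd p = r \<longrightarrow> length p \<le> R \<longrightarrow>
     distinct q \<longrightarrow> 3 \<le> length q \<longrightarrow> length q \<le> R \<longrightarrow> closed_path_edges q \<subseteq> E \<longrightarrow> last p \<notin> set q)"

lemma tree_likeD:
  assumes "tree_like R E r" "walk E p" "p \<noteq> []" "hd p = r" "length p \<le> R"
    "distinct q" "3 \<le> length q" "length q \<le> R" "closed_path_edges q \<subseteq> E"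
  shows "last p \<notin> set q"
  using assms unfolding tree_like_def by blast

text \<open>A repetition would close a cycle inside the walk, and the walk itself, stopped at the
  first node of this cycle, reaches it within the allowed length.\<close>

lemma tree_like_distinct:
  assumes "tree_like R E (hd p)" "walk E p" "nonbacktracking p" "length p \<le> R" "\<And>x. {x} \<notin> E"
  shows "distinct p"
proof (rule ccontr)
  assume nd: "\<not> distinct p"
  obtain p1 q p2 where q: "p = p1 @ q @ p2" "distinct q" "3 \<le> length q" "closed_path_edges q \<subseteq> E"
    using nonbacktracking_walk_contains_cycle[OF assms(2,3) nd assms(5)] by blast
  obtain x q' where x: "q = x # q'" using q(3) by (cases q) auto
  have "walk E (p1 @ [x])" using assms(2) q(1) x by (auto simp: successively_append_iff)
  moreover have "hd (p1 @ [x]) = hd p" using q x by (cases p1) auto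
  moreover have "length (p1 @ [x]) \<le> R" "length q \<le> R" using assms(4) q(1) x by auto
  ultimately have "last (p1 @ [x]) \<notin> set q"
    using tree_likeD[OF assms(1), of "p1 @ [x]" q] q by blast
  then show False using x by simp
qed

text \<open>Equal last nodes are stripped from the end. If the predecessors of the common end
  differ, going out along one path and back along the other is a nonbacktracking walk from
  \<open>r\<close> to \<open>r\<close>, contrary to \<open>tree_like_distinct\<close>.\<close>

lemma tree_like_unique_path:
  assumes "tree_like R E r" "\<And>x. {x} \<notin> E"
    and "walk E p" "walk E q" "distinct p" "distinct q" "p \<noteq> []" "q \<noteq> []"
    and "hd p = r" "hd q = r" "last p = last q" "length p + length q \<le> R"
  shows "p = q"
  using assms(3-)
proof (induction p arbitrary: q rule: rev_induct)
  case (snoc x p)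
  obtain q' where q: "q = q' @ [x]" using snoc.prems by (metis append_butlast_last_id last_snoc)
  show ?case
  proof (cases "p = [] \<or> q' = []")
    case True
    have "p = []" if "q' = []"
    proof (rule ccontr)
      assume "p \<noteq> []"
      then have "hd p = x" "hd p \<in> set p" using snoc.prems(7,8) q that by auto
      then show False using snoc.prems(3) by simp
    qed
    moreover have "q' = []" if "p = []"
    proof (rule ccontr)
      assume "q' \<noteq> []"
      then have "hd q' = x" "hd q' \<in> set q'" using snoc.prems(7,8) q that by auto
      then show False using snoc.prems(4) q by simp
    qed
    ultimately have "p = []" "q' = []" using True by blast+
    then show ?thesis using q by simp
  next
    case False
    have wp: "walk E p" "{last p, x} \<in> E" and wq: "walk E q'" "{last q', x} \<in> E"
      using snoc.prems q False by (auto simp: successively_append_iff)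
    have hds: "hd p = r" "hd q' = r" using snoc.prems q False by auto
    show ?thesis
    proof (cases "last p = last q'")
      case True
      have "p = q'" using snoc.prems q False True wp wq hds by (intro snoc.IH) auto
      then show ?thesis using q by simp
    next
      case neq: False
      let ?w = "p @ x # rev q'"
      have "walk E ?w" using wp wq False
        by (auto simp: successively_append_iff successively_Cons hd_rev insert_commute)
      moreover have "nonbacktracking ?w" using snoc.prems q neq False
        by (intro nonbacktracking_join) (auto simp: hd_rev)
      moreover have "hd ?w = r" "length ?w \<le> R" using False hds snoc.prems q by auto
      ultimately have "distinct ?w"
        using tree_like_distinct[of R E ?w] assms(1,2) by simp
      moreover have "r \<in> set p" "r \<in> set q'" using hds False hd_in_set by metis+
      ultimately show ?thesis by auto
    qed
  qed
qed blast

section \<open>Switching two edges\<close>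

text \<open>Removed and added edges alternate around \<open>x, y, z, w\<close>, so degrees are kept,
  and the same operation started at \<open>y\<close> undoes it.\<close>

definition switch :: "'a set set \<Rightarrow> 'a \<Rightarrow> 'a \<Rightarrow> 'a \<Rightarrow> 'a \<Rightarrow> 'a set set" where
  "switch E x y z w = E - {{x, y}, {z, w}} \<union> {{y, z}, {w, x}}"

lemma switch_switch:
  assumes "{x, y} \<in> E" "{z, w} \<in> E" "{y, z} \<notin> E" "{w, x} \<notin> E"
  shows "switch (switch E x y z w) y z w x = E"
  using assms unfolding switch_def by blast

lemma switch_flip: "switch E x y z w = switch E y x w z"
  unfolding switch_def by (auto simp: insert_commute)

lemma node_degree_switch:
  assumes "finite E" "distinct [x, y, z, w]"
    and "{x, y} \<in> E" "{z, w} \<in> E" "{y, z} \<notin> E" "{w, x} \<notin> E"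
  shows "node_degree (switch E x y z w) v = node_degree E v"
proof -
  let ?old = "{e \<in> {{x, y}, {z, w}}. v \<in> e}" and ?new = "{e \<in> {{y, z}, {w, x}}. v \<in> e}"
  let ?F = "{e \<in> E - {{x, y}, {z, w}}. v \<in> e}"
  have sets: "{e \<in> switch E x y z w. v \<in> e} = ?F \<union> ?new" "{e \<in> E. v \<in> e} = ?F \<union> ?old"
    using assms unfolding switch_def by blast+
  have "card ?old = card ?new"
  proof (cases "v \<in> {x, y, z, w}")
    case True
    then have "(\<exists>e. ?old = {e}) \<and> (\<exists>e. ?new = {e})" using assms(2) by auto
    then show ?thesis by (metis card_1_singleton_iff One_nat_def)
  next
    case False
    then have "?old = {}" "?new = {}" by auto
    then show ?thesis by (simp only:)
  qed
  moreover have "finite ?F" "finite ?new" "finite ?old" "?F \<inter> ?new = {}" "?F \<inter> ?old = {}"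
    using assms by auto
  ultimately show ?thesis
    unfolding node_degree_def sets by (simp add: card_Un_disjoint)
qed

lemma consecutive_edge_neq_closing:
  assumes "distinct q" "3 \<le> length q" "Suc i < length q"
  shows "{q ! i, q ! Suc i} \<noteq> {last q, hd q}"
proof
  assume eq: "{q ! i, q ! Suc i} = {last q, hd q}"
  have "last q = q ! (length q - 1)" "hd q = q ! 0"
    using assms(3) last_conv_nth[of q] hd_conv_nth[of q] by fastforce+
  moreover have "q ! x = q ! y \<longleftrightarrow> x = y" if "x < length q" "y < length q" for x y
    using that assms(1) by (simp add: nth_eq_iff_index_eq)
  moreover have "i < length q" "length q - 1 < length q" "0 < length q" using assms(3) by auto
  ultimately have "i = length q - 1 \<and> Suc i = 0 \<or> i = 0 \<and> Suc i = length q - 1"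
    using eq assms(3) by (simp only: doubleton_eq_iff)
  with assms show False by auto
qed

lemma finite_cycles [simp]: "finite E \<Longrightarrow> finite (cycles c E)"
  by (rule finite_subset[of _ "Pow E"]) (auto simp: cycles_def)

text \<open>The switching that closes \<open>P\<close> into a cycle, at a path
  \<open>a, P, b\<close> whose start lies far from all short cycles. Acyclicity is required of the
  graph before the switching only; \<open>R\<close> has to accommodate two competing paths from
  \<open>a\<close>.\<close>

locale local_switch =
  fixes E :: "'a set set" and a b :: 'a and P :: "'a list" and k R :: nat
  assumes no_loop: "\<And>x. {x} \<notin> E"
    and tree: "tree_like R E a"
    and path: "walk E (a # P @ [b])" "distinct (a # P @ [b])"
    and len: "3 \<le> length P" "length P \<le> k" "2 * k + 2 \<le> R"
begin

definition "E' = switch E a (hd P) (last P) b"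
text \<open>The part common to both graphs. Paths in \<open>H\<close> are paths in \<open>E\<close>
  and inherit their uniqueness.\<close>

definition "H = E - {{a, hd P}, {last P, b}}"

lemma P_ne: "P \<noteq> []" using len by auto

lemma path': "walk E P" "{a, hd P} \<in> E" "{last P, b} \<in> E" "walk E (a # P)"
  using path P_ne by (auto simp: successively_Cons successively_append_iff)

lemma hd_last: "hd P \<in> set P" "last P \<in> set P" "a \<notin> set P" "b \<notin> set P" "a \<noteq> b"
  "hd P \<noteq> last P" "distinct P"
proof -
  show "hd P \<noteq> last P" using path(2) len
    by (cases P) (auto split: if_splits)
qed (use path(2) P_ne in auto)

lemma E'_eq: "E' = H \<union> {{hd P, last P}, {a, b}}"
  unfolding E'_def H_def switch_def by (auto simp: insert_commute)

lemma no_cycle_near: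
  assumes "closed_path_edges q \<subseteq> E" "distinct q" "3 \<le> length q" "length q \<le> R"
  shows "a \<notin> set q" "hd P \<notin> set q" "last P \<notin> set q"
proof -
  note D = tree_likeD[OF tree _ _ _ _ assms(2,3,4,1)]
  show "a \<notin> set q" using D[of "[a]"] len by simp
  show "hd P \<notin> set q" using D[of "[a, hd P]"] len path' by simp
  show "last P \<notin> set q" using D[of "a # P"] len path' P_ne by simp
qed

text \<open>Either edge would close a cycle of \<open>E\<close> too near to \<open>a\<close>: on
  \<open>P\<close>, or on \<open>a # P @ [b]\<close> with at most \<open>k + 2\<close>
  nodes.\<close>

lemma not_edge: "{hd P, last P} \<notin> E" "{a, b} \<notin> E"
proof
  assume "{hd P, last P} \<in> E"
  then have "closed_path_edges P \<subseteq> E"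
    using P_ne path' by (simp add: closed_path_edges_subset_iff insert_commute)
  then show False using no_cycle_near(2)[of P] len hd_last by simp
next
  show "{a, b} \<notin> E"
  proof
    assume "{a, b} \<in> E"
    then have "closed_path_edges (a # P @ [b]) \<subseteq> E"
      using path by (subst closed_path_edges_subset_iff) (auto simp: insert_commute)
    then show False using no_cycle_near(1)[of "a # P @ [b]"] len path(2) by simp
  qed
qed

lemma new_cycle: "closed_path_edges P \<subseteq> E'"
proof -
  have "walk E' P"
    using path'(1)
  proof (rule successively_mono)
    fix x y assume "x \<in> set P" "y \<in> set P" "{x, y} \<in> E"
    then show "{x, y} \<in> E'" using hd_last unfolding E'_eq H_def by (auto simp: doubleton_eq_iff)
  qed
  then show ?thesis using P_ne by (simp add: closed_path_edges_subset_iff E'_eq insert_commute)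
qed

text \<open>The two removed edges contain \<open>a\<close> or \<open>last P\<close>, and neither
  node lies on a short cycle of \<open>E\<close>.\<close>

lemma old_cycle:
  assumes "closed_path_edges q \<subseteq> E" "distinct q" "3 \<le> length q" "length q \<le> k"
  shows "closed_path_edges q \<subseteq> E'"
proof -
  have "a \<notin> \<Union>(closed_path_edges q)" "last P \<notin> \<Union>(closed_path_edges q)"
    using no_cycle_near[OF assms(1-3)] assms(4) len by (simp_all add: Union_closed_path_edges)
  then have "{a, hd P} \<notin> closed_path_edges q" "{last P, b} \<notin> closed_path_edges q" by blast+
  then show ?thesis using assms(1) unfolding E'_eq H_def by blast
qed

text \<open>The exceptional case is the only one in which both paths together have more than
  \<open>2 * k + 2\<close> nodes. It is excluded in each application.\<close>

lemma unique_path: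
  assumes "walk E p" "distinct p" "p \<noteq> []" "hd p = a" "length p \<le> Suc k"
    and "walk E q" "distinct q" "q \<noteq> []" "hd q = a" "length q \<le> k + 2" "last p = last q"
  shows "p = q \<or> (length p = Suc k \<and> length q = k + 2)"
  using tree_like_unique_path[OF tree no_loop assms(1,6,2,7,3,8,4,9,11)] assms len by linarith

lemma walk_H: "walk H p \<Longrightarrow> walk E p"
  by (erule successively_mono) (auto simp: H_def)

text \<open>The only short paths in \<open>E\<close> from \<open>a\<close> to these nodes are
  initial segments of \<open>a # P @ [b]\<close>, whose first edge is missing in
  \<open>H\<close>.\<close>

lemma no_H_path:
  assumes "walk H p" "distinct p" "p \<noteq> []" "hd p = a" "length p \<le> k"
  shows "last p \<notin> {hd P, last P, b}"
proof
  assume "last p \<in> {hd P, last P, b}"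
  moreover have "p \<noteq> q" if "q = a # hd P # r" for q r
    using assms(1) that by (auto simp: H_def)
  moreover have "a # P = a # hd P # tl P" "a # P @ [b] = a # hd P # (tl P @ [b])"
    using P_ne by simp_all
  ultimately have neq: "p \<noteq> [a, hd P]" "p \<noteq> a # P" "p \<noteq> a # P @ [b]" by metis+
  have u: "p = q" if "walk E q" "distinct q" "q \<noteq> []" "hd q = a" "length q \<le> k + 2" "last p = last q" for q
    using unique_path[OF walk_H[OF assms(1)] assms(2-4) _ that] assms(5) by auto
  have "last p \<noteq> hd P" using u[of "[a, hd P]"] neq path' hd_last by auto
  moreover have "last p \<noteq> last P" using u[of "a # P"] neq path' hd_last P_ne len by auto
  moreover have "last p \<noteq> b" using u[of "a # P @ [b]"] neq path len by auto
  ultimately show False using \<open>last p \<in> _\<close> by blast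
qed

lemma created_cycle:
  assumes "closed_path_edges q \<subseteq> E'" "distinct q" "3 \<le> length q" "length q \<le> k"
    and "\<not> closed_path_edges q \<subseteq> E"
  shows "closed_path_edges q = closed_path_edges P"
proof (cases "{a, b} \<in> closed_path_edges q")
  case True
  obtain p where p: "closed_path_edges p = closed_path_edges q" "length p = length q"
    "distinct p" "hd p = a" "last p = b"
    using closed_path_edges_rerootE[OF True assms(2)] by blast
  have ne: "p \<noteq> []" using p(2) assms(3) by auto
  have w: "walk E' p" using assms(1) p(1) closed_path_edges_subset_iff[OF ne] by metis
  \<comment> \<open>Follow the cycle from \<open>a\<close>, away from the edge
    \<open>{a, b}\<close>, up to the first of the other three switched nodes. Neither new edge has
    been used by then, so this is a path in \<open>H\<close>, which cannot exist.\<close>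
  let ?T = "{hd P, last P, b}"
  have "\<exists>x\<in>set p. x \<in> ?T" using p(5) last_in_set[OF ne] by auto
  then obtain ys x zs where split: "p = ys @ x # zs" "x \<in> ?T" "\<forall>y\<in>set ys. y \<notin> ?T"
    using split_list_first_prop[of p "\<lambda>x. x \<in> ?T"] by blast
  define r where "r = ys @ [x]"
  have "a \<notin> ?T" using hd_last by auto
  then have "ys \<noteq> []" using split(1,2) p(4) by auto
  have pr: "p = r @ zs" using split r_def by simp
  then have r: "r \<noteq> []" "distinct r" "hd r = a" "length r \<le> k" "last r \<in> ?T"
    using p(2,3,4) assms(4) split(1,2) \<open>ys \<noteq> []\<close> by (auto simp: r_def)
  have "walk H r"
    unfolding successively_conv_nth
  proof (intro allI impI)
    fix i assume i: "Suc i < length r"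
    have "r ! i = ys ! i" "i < length ys" using i by (auto simp: r_def nth_append)
    then have notT: "r ! i \<notin> ?T" using split(3) by auto
    have ip: "Suc i < length p" "p ! i = r ! i" "p ! Suc i = r ! Suc i"
      using i pr by (auto simp: nth_append)
    then have "{r ! i, r ! Suc i} \<in> E'" using w by (metis successively_nth)
    moreover have "{r ! i, r ! Suc i} \<noteq> {hd P, last P}" using notT by (auto simp: doubleton_eq_iff)
    moreover have "{r ! i, r ! Suc i} \<noteq> {a, b}"
      using consecutive_edge_neq_closing[of p i] p assms(3) ip by (metis insert_commute)
    ultimately show "{r ! i, r ! Suc i} \<in> H" by (simp add: E'_eq)
  qed
  then show ?thesis using no_H_path[of r] r by blast
next
  case False
  then have "{hd P, last P} \<in> closed_path_edges q"
    using assms(1,5) unfolding E'_eq H_def by blast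
  from closed_path_edges_rerootE[OF this assms(2)]
  obtain p where p: "closed_path_edges p = closed_path_edges q" "length p = length q"
    "distinct p" "hd p = hd P" "last p = last P" by blast
  have ne: "p \<noteq> []" using p(2) assms(3) by auto
  have "walk H p"
    unfolding successively_conv_nth
  proof (intro allI impI)
    fix i assume i: "Suc i < length p"
    then have mem: "{p ! i, p ! Suc i} \<in> closed_path_edges p"
      using ne by (auto simp: closed_path_edges_conv)
    moreover have "{p ! i, p ! Suc i} \<noteq> {hd P, last P}"
      using consecutive_edge_neq_closing[of p i] p assms(3) i by (metis insert_commute)
    ultimately show "{p ! i, p ! Suc i} \<in> H"
      using assms(1) False p(1) unfolding E'_eq by auto
  qed
  \<comment> \<open>Otherwise the part of \<open>p\<close> up to \<open>a\<close>, reversed, would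
    lead from \<open>a\<close> to \<open>hd P\<close> within \<open>H\<close>. Hence
    \<open>a # p\<close> is a path, and uniqueness identifies it with \<open>a # P\<close>.\<close>
  have "a \<notin> set p"
  proof
    assume "a \<in> set p"
    then obtain ys zs where split: "p = ys @ a # zs" by (meson split_list)
    let ?r = "rev (ys @ [a])"
    have "walk H (ys @ [a])" using \<open>walk H p\<close> split by (auto simp: successively_append_iff)
    then have "walk H ?r" by (simp only: walk_rev)
    moreover have "ys \<noteq> []" using split p hd_last by auto
    then have "last ?r = hd P" using p split by (simp add: last_rev)
    moreover have "distinct ?r" "?r \<noteq> []" "hd ?r = a" "length ?r \<le> k"
      using p split assms(4) by auto
    ultimately show False using no_H_path[of ?r] by blast
  qed
  then have "a # p = a # P"
    using unique_path[of "a # p" "a # P"] walk_H[OF \<open>walk H p\<close>] path' p ne hd_last len P_ne assms(4)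
    by (auto simp: successively_Cons)
  then show ?thesis using p by simp
qed

lemma num_cycles_E':
  assumes "finite E" "j \<le> k"
  shows "num_cycles j E' = num_cycles j E + (if j = length P then 1 else 0)"
proof (cases "3 \<le> j")
  case True
  have "cycles j E' = cycles j E \<union> (if j = length P then {closed_path_edges P} else {})"
  proof (intro set_eqI iffI)
    fix D assume "D \<in> cycles j E'"
    then obtain q where q: "D = closed_path_edges q" "length q = j" "distinct q" "D \<subseteq> E'"
      by (auto simp: cycles_def)
    show "D \<in> cycles j E \<union> (if j = length P then {closed_path_edges P} else {})"
    proof (cases "D \<subseteq> E")
      case True
      then show ?thesis using q \<open>3 \<le> j\<close> by (auto simp: cycles_def)
    next
      case False
      then have "D = closed_path_edges P" using created_cycle[of q] q assms \<open>3 \<le> j\<close> by auto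
      moreover have "j = length P"
        using card_closed_path_edges[of q] card_closed_path_edges[of P] q \<open>3 \<le> j\<close> len hd_last
          calculation by simp
      ultimately show ?thesis by simp
    qed
  next
    fix D assume D: "D \<in> cycles j E \<union> (if j = length P then {closed_path_edges P} else {})"
    show "D \<in> cycles j E'"
    proof (cases "D \<in> cycles j E")
      case True
      then show ?thesis using old_cycle assms(2) by (auto simp: cycles_def)
    next
      case False
      then have "D = closed_path_edges P" "j = length P" using D by (auto split: if_splits)
      then show ?thesis using new_cycle len hd_last by (auto simp: cycles_def)
    qed
  qed
  moreover have "closed_path_edges P \<notin> cycles j E"
    using not_edge(1) P_ne by (auto simp: cycles_def closed_path_edges_conv[of P] insert_commute)
  ultimately show ?thesis using assms(1) by (auto simp: num_cycles_def)
next
  case False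
  then have "cycles j F = {}" for F :: "'a set set" by (auto simp: cycles_def)
  then show ?thesis using False len by (auto simp: num_cycles_def)
qed

end

section \<open>Biregular bipartite graphs\<close>

definition neighbours :: "'a set set \<Rightarrow> 'a \<Rightarrow> 'a set" where
  "neighbours E v = {x. {v, x} \<in> E}"

locale biregular_sides =
  fixes U W :: "'a set" and du dw :: nat
  assumes finite_sides: "finite U" "finite W"
    and disjoint_sides: "U \<inter> W = {}"
    and degrees_pos: "0 < du" "0 < dw"
    and balanced: "card U * du = card W * dw"
begin

abbreviation graphs :: "'a set set set" (\<open>\<G>\<close>) where
  "\<G> \<equiv> biregular_bipartite_graphs U W du dw"

definition m :: nat where "m = card U * du"
definition deg :: nat where "deg = du + dw"

lemma edgeE:
  assumes "E \<in> \<G>" "e \<in> E"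
  obtains u w where "e = {u, w}" "u \<in> U" "w \<in> W" "u \<noteq> w"
  using assms disjoint_sides unfolding biregular_bipartite_graphs_def by blast

lemma edge_cases:
  assumes "E \<in> \<G>" "{x, y} \<in> E"
  shows "x \<in> U \<and> y \<in> W \<or> x \<in> W \<and> y \<in> U"
  using assms by (elim edgeE) (auto simp: doubleton_eq_iff)

lemma edge_side:
  assumes "E \<in> \<G>" "{x, y} \<in> E"
  shows "x \<in> U \<longleftrightarrow> y \<in> W" "x \<in> W \<longleftrightarrow> y \<in> U"
  using edge_cases[OF assms] disjoint_sides by auto

lemma no_loop: "E \<in> \<G> \<Longrightarrow> {x} \<notin> E"
  using edge_cases[of E x x] disjoint_sides by auto

lemma graphs_subset: "\<G> \<subseteq> Pow (Pow (U \<union> W))"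
  unfolding biregular_bipartite_graphs_def by auto

lemma finite_graphs: "finite \<G>"
  using graphs_subset finite_sides by (meson finite_Pow_iff finite_UnI finite_subset)

lemma finite_graph: "E \<in> \<G> \<Longrightarrow> finite E"
  using graphs_subset finite_sides by (meson PowD finite_Pow_iff finite_UnI finite_subset subsetD)

lemma node_degree:
  assumes "E \<in> \<G>"
  shows "u \<in> U \<Longrightarrow> node_degree E u = du" "w \<in> W \<Longrightarrow> node_degree E w = dw"
    "node_degree E v \<le> deg"
proof -
  show U: "u \<in> U \<Longrightarrow> node_degree E u = du" and W: "w \<in> W \<Longrightarrow> node_degree E w = dw" for u w
    using assms by (auto simp: biregular_bipartite_graphs_def)
  show "node_degree E v \<le> deg"
  proof (cases "v \<in> U \<union> W")
    case True
    then show ?thesis using U W by (auto simp: deg_def)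
  next
    case False
    then have "{e \<in> E. v \<in> e} = {}" using assms by (auto elim!: edgeE)
    then show ?thesis unfolding node_degree_def by (metis card.empty le0)
  qed
qed

lemma card_neighbours:
  assumes "E \<in> \<G>"
  shows "card (neighbours E v) = node_degree E v" "finite (neighbours E v)"
proof -
  have "bij_betw (\<lambda>x. {v, x}) (neighbours E v) {e \<in> E. v \<in> e}"
    unfolding bij_betw_def
  proof
    show "inj_on (\<lambda>x. {v, x}) (neighbours E v)" by (auto simp: inj_on_def doubleton_eq_iff)
    have "e \<in> (\<lambda>x. {v, x}) ` neighbours E v" if "e \<in> E" "v \<in> e" for e
      using assms that(1)
    proof (rule edgeE)
      fix u w assume "e = {u, w}"
      then show ?thesis using that
        by (cases "v = u") (auto simp: neighbours_def insert_commute image_iff)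
    qed
    then show "(\<lambda>x. {v, x}) ` neighbours E v = {e \<in> E. v \<in> e}" by (auto simp: neighbours_def)
  qed
  then show "card (neighbours E v) = node_degree E v" "finite (neighbours E v)"
    using finite_graph[OF assms] unfolding node_degree_def
    by (auto simp: bij_betw_same_card dest: bij_betw_finite)
qed

lemma card_graph:
  assumes "E \<in> \<G>"
  shows "card E = m"
proof -
  have "\<exists>u\<in>U. u \<in> e" if "e \<in> E" for e using edgeE[OF assms that] by blast
  then have "E = (\<Union>u\<in>U. {e \<in> E. u \<in> e})" by blast
  also have "card \<dots> = (\<Sum>u\<in>U. card {e \<in> E. u \<in> e})"
  proof (rule card_UN_disjoint)
    show "\<forall>i\<in>U. \<forall>j\<in>U. i \<noteq> j \<longrightarrow> {e \<in> E. i \<in> e} \<inter> {e \<in> E. j \<in> e} = {}"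
    proof (intro ballI impI)
      fix i j assume ij: "i \<in> U" "j \<in> U" "i \<noteq> j"
      have False if "e \<in> E" "i \<in> e" "j \<in> e" for e
        using edgeE[OF assms that(1)] that ij disjoint_sides by blast
      then show "{e \<in> E. i \<in> e} \<inter> {e \<in> E. j \<in> e} = {}" by blast
    qed
  qed (use finite_sides finite_graph[OF assms] in auto)
  also have "\<dots> = m" using node_degree(1)[OF assms] by (simp add: node_degree_def m_def)
  finally show ?thesis .
qed

lemma card_incident_edges:
  assumes "E \<in> \<G>" "finite S"
  shows "card {f \<in> E. f \<inter> S \<noteq> {}} \<le> card S * deg"
proof -
  have "card {f \<in> E. f \<inter> S \<noteq> {}} \<le> card (\<Union>v\<in>S. {f \<in> E. v \<in> f})"
    using assms finite_graph by (intro card_mono) auto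
  also have "\<dots> \<le> (\<Sum>v\<in>S. card {f \<in> E. v \<in> f})" using assms(2) by (rule card_UN_le)
  also have "\<dots> \<le> (\<Sum>v\<in>S. deg)" using node_degree(3)[OF assms(1)]
    by (intro sum_mono) (simp add: node_degree_def)
  finally show ?thesis by simp
qed

lemma hd_side:
  assumes "E \<in> \<G>" "walk E q" "q \<noteq> []" "last q \<in> U"
  shows "hd q \<in> (if odd (length q) then U else W)"
  using assms(2-)
proof (induction q)
  case (Cons x q)
  show ?case
  proof (cases "q = []")
    case False
    then have "hd q \<in> (if odd (length q) then U else W)" "{x, hd q} \<in> E"
      using Cons by (auto simp: successively_Cons)
    then show ?thesis using edge_side[OF assms(1), of x "hd q"] by (auto split: if_splits)
  qed (use Cons in simp)
qed simp

lemma card_walks_from: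
  assumes "E \<in> \<G>"
  shows "finite {p. walk E p \<and> p \<noteq> [] \<and> hd p = v \<and> length p = Suc n} \<and>
    card {p. walk E p \<and> p \<noteq> [] \<and> hd p = v \<and> length p = Suc n} \<le> deg ^ n"
proof (induction n arbitrary: v)
  case 0
  have "{p. walk E p \<and> p \<noteq> [] \<and> hd p = v \<and> length p = Suc 0} = {[v]}"
    by (auto simp: length_Suc_conv)
  then show ?case by simp
next
  case (Suc n)
  let ?S = "\<lambda>v n. {p. walk E p \<and> p \<noteq> [] \<and> hd p = v \<and> length p = Suc n}"
  have eq: "?S v (Suc n) = (\<Union>x\<in>neighbours E v. (#) v ` ?S x n)"
  proof (intro set_eqI iffI)
    fix p assume p: "p \<in> ?S v (Suc n)"
    then obtain x r where "p = v # x # r" by (cases p rule: nonbacktracking.cases) auto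
    then show "p \<in> (\<Union>x\<in>neighbours E v. (#) v ` ?S x n)"
      using p by (auto simp: neighbours_def intro!: bexI[of _ x] imageI)
  qed (auto simp: neighbours_def successively_Cons)
  have "card (?S v (Suc n)) \<le> (\<Sum>x\<in>neighbours E v. card ((#) v ` ?S x n))"
    unfolding eq using card_neighbours[OF assms] by (intro card_UN_le)
  also have "\<dots> \<le> (\<Sum>x\<in>neighbours E v. deg ^ n)"
    using Suc.IH by (intro sum_mono) (simp add: card_image)
  also have "\<dots> \<le> deg ^ Suc n"
    using card_neighbours[OF assms] node_degree(3)[OF assms, of v] by simp
  finally show ?case using eq card_neighbours[OF assms] Suc.IH by auto
qed

text \<open>The \<open>n\<close> inner nodes are those of the future cycle. For even
  \<open>n\<close> the ends lie on different sides, so fixing the side of the last node selects one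
  of the two directions.\<close>

definition nb_walks :: "'a set set \<Rightarrow> nat \<Rightarrow> 'a list set" where
  "nb_walks E n = {q. length q = n + 2 \<and> walk E q \<and> nonbacktracking q \<and> last q \<in> U}"

text \<open>The number of ways to prolong an edge by \<open>n\<close> steps, with factors
  \<open>dw - 1\<close> and \<open>du - 1\<close> alternating from \<open>dw - 1\<close> on. For
  even \<open>n\<close> it is the numerator of \<open>cycle_mean du dw n\<close>.\<close>

definition growth :: "nat \<Rightarrow> nat" where
  "growth n = (dw - 1) ^ (Suc n div 2) * (du - 1) ^ (n div 2)"

text \<open>Walks grow at the head because the side of the last node is prescribed. The parity of
  \<open>n\<close> tells the side of the head, and hence how many neighbours other than the second
  node it has.\<close>

lemma card_nb_walks:
  assumes "E \<in> \<G>"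
  shows "finite (nb_walks E n) \<and> card (nb_walks E n) = m * growth n"
proof (induction n)
  case 0
  have "nb_walks E 0 = (\<lambda>(u, w). [w, u]) ` (SIGMA u:U. neighbours E u)"
    unfolding nb_walks_def neighbours_def
    by (auto simp: length_Suc_conv numeral_2_eq_2 insert_commute image_iff)
  moreover have "inj_on (\<lambda>(u, w). [w, u]) (SIGMA u:U. neighbours E u)" by (auto simp: inj_on_def)
  moreover have "finite (SIGMA u:U. neighbours E u)"
    using finite_sides card_neighbours[OF assms] by auto
  moreover have "card (SIGMA u:U. neighbours E u) = m"
    using finite_sides card_neighbours[OF assms] node_degree[OF assms] by (simp add: m_def)
  ultimately show ?case by (simp add: card_image growth_def)
next
  case (Suc n)
  let ?N = "\<lambda>q. neighbours E (hd q) - {q ! 1}"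
  let ?S = "SIGMA q:nb_walks E n. ?N q"
  have eq: "nb_walks E (Suc n) = (\<lambda>(q, v). v # q) ` ?S"
  proof (intro set_eqI iffI)
    fix p assume p: "p \<in> nb_walks E (Suc n)"
    then obtain x y z r where "p = x # y # z # r"
      by (cases p rule: nonbacktracking.cases) (auto simp: nb_walks_def)
    then show "p \<in> (\<lambda>(q, v). v # q) ` ?S"
      using p by (intro image_eqI[of _ _ "(y # z # r, x)"])
        (auto simp: nb_walks_def neighbours_def insert_commute)
  next
    fix p assume "p \<in> (\<lambda>(q, v). v # q) ` ?S"
    then obtain q v where q: "p = v # q" "q \<in> nb_walks E n" "v \<in> ?N q" by auto
    then obtain y z r where "q = y # z # r"
      by (cases q rule: nonbacktracking.cases) (auto simp: nb_walks_def)
    then show "p \<in> nb_walks E (Suc n)" using q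
      by (auto simp: nb_walks_def neighbours_def insert_commute)
  qed
  define d where "d = (if even n then dw - 1 else du - 1)"
  have card_N: "card (?N q) = d" if q: "q \<in> nb_walks E n" for q
  proof -
    obtain y z r where yz: "q = y # z # r"
      using q by (cases q rule: nonbacktracking.cases) (auto simp: nb_walks_def)
    then have "q ! 1 \<in> neighbours E (hd q)" using q by (auto simp: nb_walks_def neighbours_def)
    moreover have "hd q \<in> (if even n then W else U)"
      using hd_side[OF assms, of q] q yz by (auto simp: nb_walks_def)
    ultimately show ?thesis
      using card_neighbours[OF assms, of "hd q"] node_degree[OF assms]
      by (auto simp: d_def split: if_splits)
  qed
  have inj: "inj_on (\<lambda>(q, v). v # q) ?S" by (auto simp: inj_on_def)
  have fin: "finite (?N q)" for q using card_neighbours[OF assms] by auto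
  have "card (nb_walks E (Suc n)) = card ?S" unfolding eq using inj by (rule card_image)
  also have "\<dots> = (\<Sum>q\<in>nb_walks E n. card (?N q))"
    using fin Suc.IH by (intro card_SigmaI) auto
  also have "\<dots> = m * growth n * d" using card_N Suc.IH by simp
  also have "\<dots> = m * growth (Suc n)"
  proof (cases "even n")
    case True
    then show ?thesis by (elim evenE) (simp add: growth_def d_def)
  next
    case False
    then show ?thesis by (elim oddE) (simp add: growth_def d_def)
  qed
  finally show ?case using eq fin Suc.IH by auto
qed

lemma switch_in_graphs:
  assumes E: "E \<in> \<G>" and sides: "x \<in> U" "y \<in> W" "z \<in> U" "w \<in> W" "x \<noteq> z" "y \<noteq> w"
    and edges: "{x, y} \<in> E" "{z, w} \<in> E" "{y, z} \<notin> E" "{w, x} \<notin> E"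
  shows "switch E x y z w \<in> \<G>"
proof -
  have "distinct [x, y, z, w]" using sides disjoint_sides by auto
  then have "node_degree (switch E x y z w) v = node_degree E v" for v
    using node_degree_switch[OF finite_graph[OF E]] edges by blast
  moreover have "switch E x y z w \<subseteq> {{u, w} | u w. u \<in> U \<and> w \<in> W}"
    using E sides unfolding switch_def biregular_bipartite_graphs_def
    by (auto simp: insert_commute)
  ultimately show ?thesis using E unfolding biregular_bipartite_graphs_def by simp
qed

end

section \<open>Counting switchings\<close>

lemma switch_rotate: "switch E x y z w = switch E z w x y"
  unfolding switch_def by auto

context biregular_sides begin

text \<open>A partial function from a graph with a walk to a graph with a cycle, the closing edge
  and the other edge. It is kept as a relation because it is used as an injection in both
  directions.\<close>

definition switched ::
    "'a set set \<times> 'a set set \<times> 'a set \<times> 'a set \<Rightarrow> 'a set set \<times> 'a list \<Rightarrow> bool" where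
  "switched x y \<longleftrightarrow> (\<exists>a P b. snd y = a # P @ [b] \<and>
     x = (switch (fst y) a (hd P) (last P) b, closed_path_edges P, {last P, hd P}, {a, b}))"

lemma switched_left_unique: "switched x y \<Longrightarrow> switched x' y \<Longrightarrow> x = x'"
  unfolding switched_def by auto

text \<open>Bounds the edges that meet the surroundings of a cycle: \<open>c\<close> nodes on the
  cycle and \<open>deg\<close> neighbours for each end of the closing edge, every node being in at
  most \<open>deg\<close> edges.\<close>

definition collisions :: "nat \<Rightarrow> nat" where
  "collisions c = (c + 2 * deg) * deg"

text \<open>The other edge must avoid the cycle so that a path arises, and the neighbours of the
  ends of \<open>e\<close> so that the added edges are new.\<close>

definition cycle_surroundings :: "'a set set \<Rightarrow> 'a set set \<Rightarrow> 'a set \<Rightarrow> 'a set" where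
  "cycle_surroundings E D e = \<Union>D \<union> (\<Union>v\<in>e. neighbours E v)"

lemma card_safe_edges:
  assumes "E \<in> \<G>" "D \<in> cycles c E" "e \<in> D"
  shows "m - collisions c \<le> card {f \<in> E. f \<inter> cycle_surroundings E D e = {}}"
proof -
  let ?S = "cycle_surroundings E D e"
  obtain p where p: "D = closed_path_edges p" "length p = c" "D \<subseteq> E"
    using assms(2) by (auto simp: cycles_def)
  have e: "finite e" "card e \<le> 2"
    using assms(1,3) p(3) by (auto elim!: edgeE[of E e] simp: card_insert_if)
  have nb: "finite (neighbours E v)" "card (neighbours E v) \<le> deg" for v
    using card_neighbours[OF assms(1)] node_degree(3)[OF assms(1)] by auto
  have "card (\<Union>v\<in>e. neighbours E v) \<le> (\<Sum>v\<in>e. card (neighbours E v))"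
    using e by (intro card_UN_le)
  also have "\<dots> \<le> (\<Sum>v\<in>e. deg)" using nb by (intro sum_mono)
  also have "\<dots> \<le> 2 * deg" using e by simp
  finally have "card (\<Union>v\<in>e. neighbours E v) \<le> 2 * deg" .
  moreover have "card (\<Union>D) \<le> c" using p by (auto simp: Union_closed_path_edges card_length)
  ultimately have "card ?S \<le> c + 2 * deg"
    unfolding cycle_surroundings_def by (meson add_mono card_Un_le order_trans)
  moreover have "finite ?S"
    unfolding cycle_surroundings_def p(1) Union_closed_path_edges using e nb by auto
  ultimately have "card {f \<in> E. f \<inter> ?S \<noteq> {}} \<le> collisions c"
    using card_incident_edges[OF assms(1), of ?S] unfolding collisions_def
    by (meson le_trans mult_le_mono1)
  moreover have "{f \<in> E. f \<inter> ?S = {}} = E - {f \<in> E. f \<inter> ?S \<noteq> {}}" by blast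
  then have "card {f \<in> E. f \<inter> ?S = {}} = card E - card {f \<in> E. f \<inter> ?S \<noteq> {}}"
    using finite_graph[OF assms(1)] by (simp add: card_Diff_subset)
  ultimately show ?thesis using card_graph[OF assms(1)] by simp
qed

lemma cycle_switch_exists:
  assumes E: "E \<in> \<G>" and D: "D \<in> cycles c E" "e \<in> D"
    and f: "f \<in> E" "f \<inter> cycle_surroundings E D e = {}"
  shows "\<exists>y \<in> (SIGMA E':\<G>. nb_walks E' c). switched (E, D, e, f) y"
proof -
  obtain p where p: "D = closed_path_edges p" "length p = c" "3 \<le> c" "distinct p" "D \<subseteq> E"
    using D(1) by (auto simp: cycles_def)
  \<comment> \<open>The sides fix how the ends are joined: \<open>s\<close> and \<open>b\<close> lie
    in \<open>U\<close>, \<open>t\<close> and \<open>a\<close> in \<open>W\<close>, so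
    \<open>{a, s}\<close> and \<open>{t, b}\<close> respect the bipartition and the walk ends in
    \<open>U\<close>.\<close>
  obtain s t where e: "e = {s, t}" "s \<in> U" "t \<in> W" using edgeE[OF E, of e] D p by blast
  obtain b a where f_eq: "f = {b, a}" "b \<in> U" "a \<in> W" using edgeE[OF E f(1)] by blast
  obtain P where P: "closed_path_edges P = D" "length P = c" "distinct P" "hd P = s" "last P = t"
    using closed_path_edges_rerootE[of s t p] p D(2) e(1) by metis
  have ne: "P \<noteq> []" using P(2) p(3) by auto
  have "a \<notin> set P" "b \<notin> set P"
    using f(2) f_eq(1) unfolding cycle_surroundings_def P(1)[symmetric] Union_closed_path_edges by auto
  have "s \<in> set P" "t \<in> set P" using P ne by auto
  then have neq: "s \<noteq> b" "t \<noteq> a" using \<open>a \<notin> set P\<close> \<open>b \<notin> set P\<close> by auto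
  have new: "{t, b} \<notin> E" "{a, s} \<notin> E"
    using f(2) f_eq(1) e(1) by (auto simp: cycle_surroundings_def neighbours_def insert_commute)
  have old: "{s, t} \<in> E" "{b, a} \<in> E" using D(2) p(5) e(1) f(1) f_eq(1) by auto
  define E' where "E' = switch E s t b a"
  have E': "E' \<in> \<G>" unfolding E'_def
    using switch_in_graphs[OF E e(2,3) f_eq(2,3) neq old new] .
  have restored: "switch E' a s t b = E"
    using switch_switch[OF old new] switch_rotate unfolding E'_def by metis
  have "walk E' P"
    unfolding successively_conv_nth
  proof (intro allI impI)
    fix i assume i: "Suc i < length P"
    then have "{P ! i, P ! Suc i} \<in> closed_path_edges P"
      using ne by (auto simp: closed_path_edges_conv)
    moreover have "{P ! i, P ! Suc i} \<noteq> {s, t}"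
      using consecutive_edge_neq_closing[of P i] P p(3) i by (metis insert_commute)
    moreover have "P ! i \<in> set P" "P ! Suc i \<in> set P" using i by auto
    then have "{P ! i, P ! Suc i} \<noteq> {b, a}"
      using \<open>a \<notin> set P\<close> by (auto simp: doubleton_eq_iff)
    ultimately show "{P ! i, P ! Suc i} \<in> E'" using P(1) p(5) by (auto simp: E'_def switch_def)
  qed
  moreover have "{a, s} \<in> E'" "{t, b} \<in> E'" by (auto simp: E'_def switch_def)
  ultimately have "walk E' (a # P @ [b])"
    using ne P by (auto simp: successively_Cons successively_append_iff)
  moreover have "a \<noteq> b" using f_eq disjoint_sides by auto
  then have "distinct (a # P @ [b])" using \<open>a \<notin> set P\<close> \<open>b \<notin> set P\<close> P by auto
  ultimately have "a # P @ [b] \<in> nb_walks E' c"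
    using P f_eq nonbacktracking_if_distinct[of "a # P @ [b]"] by (simp add: nb_walks_def)
  moreover have "switched (E, D, e, f) (E', a # P @ [b])"
    unfolding switched_def using P e f_eq restored
    by (intro exI[of _ a] exI[of _ P] exI[of _ b]) (auto simp: insert_commute)
  ultimately show ?thesis using E' by blast
qed

lemma card_cycle:
  assumes "D \<in> cycles c E"
  shows "card D = c" "finite D"
  using assms by (auto simp: cycles_def card_closed_path_edges)

text \<open>Double counting: a walk determines the graph, the cycle and the two edges that it came
  from. If \<open>m\<close> is small, truncated subtraction makes the left side 0.\<close>

lemma sum_num_cycles_le:
  "(\<Sum>E\<in>\<G>. num_cycles c E) * (c * (m - collisions c)) \<le> card \<G> * (m * growth c)"
proof -
  let ?ok = "\<lambda>E D e. {f \<in> E. f \<inter> cycle_surroundings E D e = {}}"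
  let ?A = "SIGMA E:\<G>. SIGMA D:cycles c E. SIGMA e:D. ?ok E D e"
  let ?T = "SIGMA E:\<G>. nb_walks E c"
  have fin_ok: "finite (?ok E D e)" if "E \<in> \<G>" for E D e using finite_graph[OF that] by simp
  have "(\<Sum>E\<in>\<G>. num_cycles c E) * (c * (m - collisions c))
      = (\<Sum>E\<in>\<G>. \<Sum>D\<in>cycles c E. \<Sum>e\<in>D. m - collisions c)"
    by (simp add: card_cycle num_cycles_def sum_distrib_right mult.assoc)
  also have "\<dots> \<le> (\<Sum>E\<in>\<G>. \<Sum>D\<in>cycles c E. \<Sum>e\<in>D. card (?ok E D e))"
    by (intro sum_mono card_safe_edges)
  also have "\<dots> = (\<Sum>E\<in>\<G>. \<Sum>D\<in>cycles c E. card (SIGMA e:D. ?ok E D e))"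
    using fin_ok by (intro sum.cong refl) (simp add: card_SigmaI card_cycle)
  also have "\<dots> = (\<Sum>E\<in>\<G>. card (SIGMA D:cycles c E. SIGMA e:D. ?ok E D e))"
    using fin_ok finite_graph
    by (intro sum.cong refl card_SigmaI[symmetric]) (auto simp: card_cycle intro!: finite_SigmaI)
  also have "\<dots> = card ?A"
    using fin_ok finite_graph finite_graphs
    by (intro card_SigmaI[symmetric]) (auto simp: card_cycle intro!: finite_SigmaI)
  also have "\<dots> \<le> card ?T"
  proof (rule card_le_if_inj_on_rel[where r = switched])
    show "finite ?T" using finite_graphs card_nb_walks by (intro finite_SigmaI) auto
    show "\<exists>y. y \<in> ?T \<and> switched x y" if "x \<in> ?A" for x
      using that cycle_switch_exists by fastforce
  qed (use switched_left_unique in blast)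
  also have "\<dots> = (\<Sum>E\<in>\<G>. card (nb_walks E c))"
    using finite_graphs card_nb_walks by (intro card_SigmaI) auto
  also have "\<dots> = card \<G> * (m * growth c)" using card_nb_walks by simp
  finally show ?thesis .
qed

section \<open>Closing tree-like walks into cycles\<close>

lemma tree_like_nb_walkE:
  assumes E: "E \<in> \<G>" and c: "even c" "3 \<le> c" "c \<le> k"
    and q: "q \<in> nb_walks E c" "tree_like (2 * k + 2) E (hd q)"
  obtains a P b where "q = a # P @ [b]" "length P = c" "local_switch E a b P k (2 * k + 2)"
    "a \<in> W" "b \<in> U" "hd P \<in> U" "last P \<in> W"
proof -
  obtain a q' where "q = a # q'" using q by (cases q) (auto simp: nb_walks_def)
  moreover obtain P b where "q' = P @ [b]"
    using q calculation by (cases q' rule: rev_cases) (auto simp: nb_walks_def)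
  ultimately have eq: "q = a # P @ [b]" by simp
  have len: "length P = c" using q eq by (simp add: nb_walks_def)
  have ne: "P \<noteq> []" using len c by auto
  have "walk E q" "b \<in> U" using q eq by (auto simp: nb_walks_def)
  moreover have "distinct q"
    using tree_like_distinct[OF q(2)] q(1) no_loop[OF E] c by (auto simp: nb_walks_def)
  ultimately have "local_switch E a b P k (2 * k + 2)"
    using no_loop[OF E] q(2) eq len c by unfold_locales auto
  moreover have edges: "walk E (P @ [b])" "{a, hd P} \<in> E" "{last P, b} \<in> E"
    using \<open>walk E q\<close> eq ne by (auto simp: successively_Cons successively_append_iff)
  \<comment> \<open>\<open>P @ [b]\<close> has the odd number \<open>c + 1\<close> of nodes, so its
    ends lie on the same side.\<close>
  then have "hd P \<in> U"
    using hd_side[OF E edges(1)] c(1) len ne \<open>b \<in> U\<close> by simp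
  moreover have "a \<in> W" "last P \<in> W"
    using edge_side[OF E edges(2)] edge_side[OF E edges(3)] \<open>hd P \<in> U\<close> \<open>b \<in> U\<close> by auto
  ultimately show thesis using that eq len \<open>b \<in> U\<close> by blast
qed

text \<open>The sides tell which ends of the two unordered edges are \<open>hd P\<close>,
  \<open>last P\<close>, \<open>a\<close> and \<open>b\<close>. Switching back recovers the graph,
  and in that graph the short path from \<open>a\<close> to \<open>last P\<close> is unique.\<close>

lemma switched_right_unique:
  assumes c: "even c" "3 \<le> c" "c \<le> k"
    and 1: "E1 \<in> \<G>" "q1 \<in> nb_walks E1 c" "tree_like (2 * k + 2) E1 (hd q1)" "switched x (E1, q1)"
    and 2: "E2 \<in> \<G>" "q2 \<in> nb_walks E2 c" "tree_like (2 * k + 2) E2 (hd q2)" "switched x (E2, q2)"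
  shows "(E1, q1) = (E2, q2)"
proof -
  obtain a P b where w1: "q1 = a # P @ [b]" "length P = c" "local_switch E1 a b P k (2 * k + 2)"
    "a \<in> W" "b \<in> U" "hd P \<in> U" "last P \<in> W"
    using tree_like_nb_walkE[OF 1(1) c 1(2,3)] by blast
  obtain a' P' b' where w2: "q2 = a' # P' @ [b']" "length P' = c"
    "local_switch E2 a' b' P' k (2 * k + 2)" "a' \<in> W" "b' \<in> U" "hd P' \<in> U" "last P' \<in> W"
    using tree_like_nb_walkE[OF 2(1) c 2(2,3)] by blast
  interpret l1: local_switch E1 a b P k "2 * k + 2" by fact
  interpret l2: local_switch E2 a' b' P' k "2 * k + 2" by fact
  have x: "x = (l1.E', closed_path_edges P, {last P, hd P}, {a, b})"
    "x = (l2.E', closed_path_edges P', {last P', hd P'}, {a', b'})"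
    using 1(4) 2(4) w1(1) w2(1) unfolding switched_def l1.E'_def l2.E'_def by auto
  then have same: "hd P' = hd P" "last P' = last P" "a' = a" "b' = b" "l2.E' = l1.E'"
    using w1(4-) w2(4-) disjoint_sides by (auto simp: doubleton_eq_iff)
  have "E1 = switch l1.E' (hd P) (last P) b a" "E2 = switch l2.E' (hd P') (last P') b' a'"
    unfolding l1.E'_def l2.E'_def
    using l1.path' l2.path' l1.not_edge l2.not_edge
    by (subst switch_switch; simp add: insert_commute)+
  then have "E1 = E2" using same by simp
  moreover have "a # P = a # P'"
  proof -
    have "walk E1 (a # P')" using l2.path'(4) \<open>E1 = E2\<close> same(3) by simp
    moreover have "distinct (a # P)" "distinct (a # P')"
      using l1.hd_last(3,7) l2.hd_last(3,7) same(3) by simp_all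
    moreover have "last (a # P) = last (a # P')" using same(2) l1.P_ne l2.P_ne by simp
    moreover have "length (a # P) \<le> Suc k" "length (a # P') \<le> k + 2"
      "length (a # P) = length (a # P')" using w1(2) w2(2) c by simp_all
    ultimately show ?thesis using l1.unique_path[OF l1.path'(4), of "a # P'"] by simp
  qed
  ultimately show ?thesis unfolding w1(1) w2(1) same(3,4) by simp
qed

lemma walk_switch_exists:
  assumes E: "E \<in> \<G>" and c: "even c" "3 \<le> c" "c \<le> k"
    and q: "q \<in> nb_walks E c" "tree_like (2 * k + 2) E (hd q)"
  obtains F D e f where "switched (F, D, e, f) (E, q)" "F \<in> \<G>" "D \<in> cycles c F" "e \<in> D" "f \<in> F"
    "\<forall>j\<le>k. num_cycles j F = num_cycles j E + (if j = c then 1 else 0)"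
proof -
  obtain a P b where w: "q = a # P @ [b]" "length P = c" "local_switch E a b P k (2 * k + 2)"
    "a \<in> W" "b \<in> U" "hd P \<in> U" "last P \<in> W"
    using tree_like_nb_walkE[OF E c q] by blast
  interpret l: local_switch E a b P k "2 * k + 2" by fact
  have "l.E' = switch E (hd P) a b (last P)" unfolding l.E'_def by (rule switch_flip)
  moreover have "hd P \<noteq> b" "a \<noteq> last P" using l.hd_last by auto
  ultimately have "l.E' \<in> \<G>"
    using switch_in_graphs[OF E w(6,4,5,7)] l.path' l.not_edge by (simp add: insert_commute)
  moreover have "switched (l.E', closed_path_edges P, {last P, hd P}, {a, b}) (E, q)"
    unfolding switched_def l.E'_def using w(1)
    by (intro exI[of _ a] exI[of _ P] exI[of _ b]) simp
  moreover have "closed_path_edges P \<in> cycles c l.E'"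
    using l.new_cycle l.hd_last w(2) c by (auto simp: cycles_def)
  moreover have "{last P, hd P} \<in> closed_path_edges P"
    using l.P_ne by (simp add: closed_path_edges_conv)
  moreover have "{a, b} \<in> l.E'" by (simp add: l.E'_eq)
  moreover have "\<forall>j\<le>k. num_cycles j l.E' = num_cycles j E + (if j = c then 1 else 0)"
    using l.num_cycles_E'[OF finite_graph[OF E]] w(2) by simp
  ultimately show thesis using that by blast
qed

lemma sum_tree_like_walks_le:
  assumes c: "even c" "3 \<le> c" "c \<le> k" and AB: "A \<subseteq> \<G>" "B \<subseteq> \<G>"
    and closed: "\<And>E F. E \<in> A \<Longrightarrow> F \<in> \<G> \<Longrightarrow>
      \<forall>j\<le>k. num_cycles j F = num_cycles j E + (if j = c then 1 else 0) \<Longrightarrow> F \<in> B"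
  shows "(\<Sum>E\<in>A. card {q \<in> nb_walks E c. tree_like (2 * k + 2) E (hd q)})
    \<le> (\<Sum>F\<in>B. num_cycles c F) * (c * m)"
proof -
  let ?good = "\<lambda>E. {q \<in> nb_walks E c. tree_like (2 * k + 2) E (hd q)}"
  let ?T = "SIGMA F:B. SIGMA D:cycles c F. SIGMA e:D. F"
  have fin: "finite A" "finite B" using AB finite_graphs finite_subset by blast+
  have fin_good: "finite (?good E)" if "E \<in> A" for E
    using that AB card_nb_walks[of E] by auto
  have finB: "finite F" "card F = m" if "F \<in> B" for F
    using that AB finite_graph card_graph by auto
  have fin1: "finite (SIGMA e:D. F)" if "F \<in> B" "D \<in> cycles c F" for F D
    using finB that card_cycle by (intro finite_SigmaI)
  have fin2: "finite (SIGMA D:cycles c F. SIGMA e:D. F)" if "F \<in> B" for F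
    using finB that card_cycle(2) by (intro finite_SigmaI finite_cycles) auto
  have "(\<Sum>E\<in>A. card (?good E)) = card (SIGMA E:A. ?good E)"
    using fin fin_good by (intro card_SigmaI[symmetric]) auto
  also have "\<dots> \<le> card ?T"
  proof (rule card_le_if_inj_on_rel[where r = "\<lambda>y x. switched x y"])
    show "finite ?T" by (rule finite_SigmaI[OF fin(2) fin2])
  next
    fix y assume "y \<in> (SIGMA E:A. ?good E)"
    then obtain E q where y: "y = (E, q)" "E \<in> A" "E \<in> \<G>" "q \<in> nb_walks E c"
      "tree_like (2 * k + 2) E (hd q)" using AB by auto
    from walk_switch_exists[OF y(3) c y(4,5)] obtain F D e f where
      F: "switched (F, D, e, f) (E, q)" "F \<in> \<G>" "D \<in> cycles c F" "e \<in> D" "f \<in> F"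
      "\<forall>j\<le>k. num_cycles j F = num_cycles j E + (if j = c then 1 else 0)" by blast
    then have "F \<in> B" using closed y(2) by blast
    then show "\<exists>x. x \<in> ?T \<and> switched x y" using F y(1) by blast
  next
    fix y y' x assume y: "y \<in> (SIGMA E:A. ?good E)" "y' \<in> (SIGMA E:A. ?good E)"
      "switched x y" "switched x y'"
    obtain E q where eq: "y = (E, q)" by (cases y)
    obtain E' q' where eq': "y' = (E', q')" by (cases y')
    have "E \<in> \<G>" "q \<in> nb_walks E c" "tree_like (2 * k + 2) E (hd q)"
      using y(1) eq AB(1) by auto
    moreover have "E' \<in> \<G>" "q' \<in> nb_walks E' c" "tree_like (2 * k + 2) E' (hd q')"
      using y(2) eq' AB(1) by auto
    ultimately show "y = y'"
      using switched_right_unique[OF c, of E q x E' q'] y(3,4) eq eq' by blast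
  qed
  also have "\<dots> = (\<Sum>F\<in>B. card (SIGMA D:cycles c F. SIGMA e:D. F))"
    by (rule card_SigmaI[OF fin(2)]) (use fin2 in blast)
  also have "\<dots> = (\<Sum>F\<in>B. \<Sum>D\<in>cycles c F. card (SIGMA e:D. F))"
    using finB fin1 card_cycle(2)
    by (intro sum.cong refl card_SigmaI finite_cycles) auto
  also have "\<dots> = (\<Sum>F\<in>B. \<Sum>D\<in>cycles c F. c * m)"
    using finB by (intro sum.cong refl) (auto simp: card_cartesian_product dest: card_cycle(1))
  also have "\<dots> = (\<Sum>F\<in>B. num_cycles c F) * (c * m)"
    by (simp add: num_cycles_def sum_distrib_right)
  finally show ?thesis .
qed

section \<open>Walks that start near a short cycle\<close>

lemma card_not_tree_like:
  assumes E: "E \<in> \<G>"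
  shows "finite {r. \<not> tree_like R E r} \<and>
    card {r. \<not> tree_like R E r} \<le> (\<Sum>j=3..R. num_cycles j E) * (R * (R * deg ^ R))"
proof -
  have deg1: "1 \<le> deg" using degrees_pos by (simp add: deg_def)
  let ?W = "\<lambda>v n. {p. walk E p \<and> p \<noteq> [] \<and> hd p = v \<and> length p = Suc n}"
  let ?X = "\<Union>j\<in>{3..R}. \<Union>D\<in>cycles j E. \<Union>v\<in>\<Union>D. \<Union>n\<in>{..<R}. last ` ?W v n"
  \<comment> \<open>Reversed walks reach the bad roots from the short cycles: one of at most
    \<open>R\<close> nodes of a cycle, one of \<open>R\<close> walk lengths, and at most
    \<open>deg ^ R\<close> walks of each length.\<close>
  have sub: "{r. \<not> tree_like R E r} \<subseteq> ?X"
  proof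
    fix r assume "r \<in> {r. \<not> tree_like R E r}"
    then obtain p q where pq: "walk E p" "p \<noteq> []" "hd p = r" "length p \<le> R" "distinct q"
      "3 \<le> length q" "length q \<le> R" "closed_path_edges q \<subseteq> E" "last p \<in> set q"
      by (auto simp: tree_like_def)
    have "rev p \<in> ?W (last p) (length p - 1)" using pq by (simp only: walk_rev mem_Collect_eq) (simp add: hd_rev)
    moreover have "last (rev p) = r" using pq by (simp add: last_rev)
    moreover have "length p - 1 \<in> {..<R}" using pq by (cases p) auto
    moreover have "last p \<in> \<Union>(closed_path_edges q)" using pq by (simp add: Union_closed_path_edges)
    moreover have "closed_path_edges q \<in> cycles (length q) E" using pq by (auto simp: cycles_def)
    moreover have "length q \<in> {3..R}" using pq by simp
    ultimately show "r \<in> ?X" by blast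
  qed
  have W: "finite (last ` ?W v n)" "card (last ` ?W v n) \<le> deg ^ n" for v n
    using card_walks_from[OF E, of v n] by (auto intro: le_trans[OF card_image_le])
  have step1: "finite (\<Union>n\<in>{..<R}. last ` ?W v n) \<and> card (\<Union>n\<in>{..<R}. last ` ?W v n) \<le> R * deg ^ R" for v
  proof
    have "card (\<Union>n\<in>{..<R}. last ` ?W v n) \<le> (\<Sum>n\<in>{..<R}. card (last ` ?W v n))"
      by (rule card_UN_le) simp
    also have "\<dots> \<le> (\<Sum>n\<in>{..<R}. deg ^ R)"
      using W deg1 by (intro sum_mono) (meson le_trans lessThan_iff less_imp_le power_increasing)
    finally show "card (\<Union>n\<in>{..<R}. last ` ?W v n) \<le> R * deg ^ R" by simp
  qed (use W in simp)
  have step2: "finite (\<Union>v\<in>\<Union>D. \<Union>n\<in>{..<R}. last ` ?W v n) \<and>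
      card (\<Union>v\<in>\<Union>D. \<Union>n\<in>{..<R}. last ` ?W v n) \<le> R * (R * deg ^ R)"
    if D: "D \<in> cycles j E" and j: "j \<in> {3..R}" for D j
  proof -
    obtain q where q: "\<Union>D = set q" "length q = j"
      using D by (auto simp: cycles_def Union_closed_path_edges)
    have "card (\<Union>v\<in>set q. \<Union>n\<in>{..<R}. last ` ?W v n) \<le> (\<Sum>v\<in>set q. card (\<Union>n\<in>{..<R}. last ` ?W v n))"
      by (rule card_UN_le) simp
    also have "\<dots> \<le> (\<Sum>v\<in>set q. R * deg ^ R)" using step1 by (intro sum_mono) blast
    also have "\<dots> = card (set q) * (R * deg ^ R)" by simp
    also have "\<dots> \<le> R * (R * deg ^ R)"
      using card_length[of q] q(2) j by (intro mult_right_mono) auto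
    finally show ?thesis using step1 unfolding q(1) by blast
  qed
  have step3: "finite (\<Union>D\<in>cycles j E. \<Union>v\<in>\<Union>D. \<Union>n\<in>{..<R}. last ` ?W v n) \<and>
      card (\<Union>D\<in>cycles j E. \<Union>v\<in>\<Union>D. \<Union>n\<in>{..<R}. last ` ?W v n) \<le> num_cycles j E * (R * (R * deg ^ R))"
    if j: "j \<in> {3..R}" for j
  proof
    have "card (\<Union>D\<in>cycles j E. \<Union>v\<in>\<Union>D. \<Union>n\<in>{..<R}. last ` ?W v n)
        \<le> (\<Sum>D\<in>cycles j E. card (\<Union>v\<in>\<Union>D. \<Union>n\<in>{..<R}. last ` ?W v n))"
      by (rule card_UN_le) (simp add: finite_graph[OF E])
    also have "\<dots> \<le> (\<Sum>D\<in>cycles j E. R * (R * deg ^ R))"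
      using step2 j by (intro sum_mono) blast
    finally show "card (\<Union>D\<in>cycles j E. \<Union>v\<in>\<Union>D. \<Union>n\<in>{..<R}. last ` ?W v n) \<le> num_cycles j E * (R * (R * deg ^ R))"
      by (simp add: num_cycles_def)
    show "finite (\<Union>D\<in>cycles j E. \<Union>v\<in>\<Union>D. \<Union>n\<in>{..<R}. last ` ?W v n)"
      by (rule finite_UN_I[OF finite_cycles[OF finite_graph[OF E]]]) (use step2 j in blast)
  qed
  have "finite ?X" by (rule finite_UN_I[OF finite_atLeastAtMost]) (use step3 in blast)
  moreover have "card ?X \<le> (\<Sum>j=3..R. num_cycles j E) * (R * (R * deg ^ R))"
  proof -
    have "card ?X \<le> (\<Sum>j=3..R. card (\<Union>D\<in>cycles j E. \<Union>v\<in>\<Union>D. \<Union>n\<in>{..<R}. last ` ?W v n))"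
      by (rule card_UN_le) simp
    also have "\<dots> \<le> (\<Sum>j=3..R. num_cycles j E * (R * (R * deg ^ R)))"
      using step3 by (intro sum_mono) blast
    finally show ?thesis by (simp only: sum_distrib_right)
  qed
  ultimately show ?thesis using sub by (meson card_mono finite_subset le_trans)
qed

lemma card_not_tree_like_walks:
  assumes E: "E \<in> \<G>"
  shows "card {q \<in> nb_walks E c. \<not> tree_like R E (hd q)}
    \<le> (\<Sum>j=3..R. num_cycles j E) * (R * (R * deg ^ R)) * deg ^ Suc c"
proof -
  let ?W = "\<lambda>v. {p. walk E p \<and> p \<noteq> [] \<and> hd p = v \<and> length p = Suc (Suc c)}"
  let ?B = "{r. \<not> tree_like R E r}"
  have fin: "finite ?B" "finite (?W v)" for v
    using card_not_tree_like[OF E] card_walks_from[OF E] by auto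
  have "{q \<in> nb_walks E c. \<not> tree_like R E (hd q)} \<subseteq> (\<Union>r\<in>?B. ?W r)"
    by (auto simp: nb_walks_def)
  then have "card {q \<in> nb_walks E c. \<not> tree_like R E (hd q)} \<le> card (\<Union>r\<in>?B. ?W r)"
    using fin by (intro card_mono) auto
  also have "\<dots> \<le> (\<Sum>r\<in>?B. card (?W r))" using fin by (intro card_UN_le)
  also have "\<dots> \<le> (\<Sum>r\<in>?B. deg ^ Suc c)" using card_walks_from[OF E] by (intro sum_mono) blast
  also have "\<dots> = card ?B * deg ^ Suc c" by simp
  also have "\<dots> \<le> (\<Sum>j=3..R. num_cycles j E) * (R * (R * deg ^ R)) * deg ^ Suc c"
    using card_not_tree_like[OF E, of R] by (intro mult_right_mono) auto
  finally show ?thesis .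
qed

end

section \<open>Poisson limits from an approximate Stein identity\<close>

text \<open>An iterated limit, in \<open>n\<close> for a fixed scale \<open>b\<close> and then in
  \<open>b\<close>. Nothing is uniform in \<open>b\<close>, so errors may be multiplied by the size
  of a box.\<close>

lemma tendsto_zero_two_scale:
  fixes a :: "nat \<Rightarrow> real"
  assumes bound: "\<And>b. \<forall>\<^sub>F n in sequentially. \<bar>a n\<bar> \<le> h b n"
    and lim: "\<And>b. h b \<longlonglongrightarrow> H b" and H: "H \<longlonglongrightarrow> 0"
  shows "a \<longlonglongrightarrow> 0"
proof (rule tendstoI)
  fix d :: real assume "0 < d"
  then have "\<forall>\<^sub>F b in sequentially. H b < d" using order_tendstoD(2)[OF H] by blast
  then obtain b where "H b < d" using eventually_sequentially by auto
  then have "\<forall>\<^sub>F n in sequentially. h b n < d" using order_tendstoD(2)[OF lim] by blast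
  with bound[of b] show "\<forall>\<^sub>F n in sequentially. dist (a n) 0 < d"
    by eventually_elim simp
qed

lemma sum_pmf_le_expectation:
  fixes f :: "'a \<Rightarrow> real"
  assumes "finite B" "integrable (measure_pmf Q) f" "\<And>x. 0 \<le> f x"
  shows "(\<Sum>x\<in>B. f x * pmf Q x) \<le> measure_pmf.expectation Q f"
proof -
  have "(\<Sum>x\<in>B. f x * pmf Q x) = measure_pmf.expectation Q (\<lambda>x. f x * indicator B x)"
    using assms(1) by (subst integral_measure_pmf_real[where A = B])
      (auto simp: indicator_def split: if_splits)
  also have "\<dots> \<le> measure_pmf.expectation Q f"
    using assms by (intro integral_mono integrable_mult_indicator[where 'b = real, simplified, simplified mult.commute])
      (auto simp: indicator_def)
  finally show ?thesis .
qed

lemma integrable_measure_pmf_bounded: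
  fixes f :: "'a \<Rightarrow> real"
  assumes "\<And>x. \<bar>f x\<bar> \<le> M"
  shows "integrable (measure_pmf Q) f"
  using assms by (intro measure_pmf.integrable_const_bound[where B = M] AE_I2) auto

text \<open>No mass can escape: what \<open>P n\<close> leaves outside the finite set
  \<open>C b\<close> is 1 minus a finite sum, hence converges to what \<open>Q\<close> leaves
  there.\<close>

lemma expectation_tendsto:
  fixes f :: "'a \<Rightarrow> real"
  assumes conv: "\<And>x. (\<lambda>n. pmf (P n) x) \<longlonglongrightarrow> pmf Q x"
    and C: "\<And>b. finite (C b)" "(\<lambda>b. measure_pmf.prob Q (C b)) \<longlonglongrightarrow> 1"
    and M: "\<And>x. \<bar>f x\<bar> \<le> M"
  shows "(\<lambda>n. measure_pmf.expectation (P n) f) \<longlonglongrightarrow> measure_pmf.expectation Q f"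
proof -
  have split: "\<bar>measure_pmf.expectation R f - (\<Sum>x\<in>C b. f x * pmf R x)\<bar>
      \<le> M * (1 - measure_pmf.prob R (C b))" for R b
  proof -
    have "0 \<le> M" using order_trans[OF abs_ge_zero M] .
    then have i: "integrable (measure_pmf R) f"
      and i1: "integrable (measure_pmf R) (\<lambda>x. f x * indicator (C b) x)"
      and i2: "integrable (measure_pmf R) (\<lambda>x. f x * indicator (- C b) x)"
      using M by (auto intro!: integrable_measure_pmf_bounded[where M = M] simp: indicator_def)
    have i3: "integrable (measure_pmf R) (\<lambda>x. M * indicator (- C b) x)"
      by (rule integrable_measure_pmf_bounded[where M = M])
        (use \<open>0 \<le> M\<close> in \<open>simp add: indicator_def\<close>)
    have "(\<Sum>x\<in>C b. f x * pmf R x) = measure_pmf.expectation R (\<lambda>x. f x * indicator (C b) x)"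
      using C(1) by (subst integral_measure_pmf_real[where A = "C b"])
        (auto simp: indicator_def split: if_splits)
    then have "measure_pmf.expectation R f - (\<Sum>x\<in>C b. f x * pmf R x)
        = measure_pmf.expectation R (\<lambda>x. f x - f x * indicator (C b) x)"
      using i i1 by simp
    also have "(\<lambda>x. f x - f x * indicator (C b) x) = (\<lambda>x. f x * indicator (- C b) x)"
      by (auto simp: indicator_def)
    also have "\<bar>measure_pmf.expectation R (\<lambda>x. f x * indicator (- C b) x)\<bar>
        \<le> measure_pmf.expectation R (\<lambda>x. \<bar>f x * indicator (- C b) x\<bar>)"
      by (rule integral_abs_bound)
    also have "\<dots> \<le> measure_pmf.expectation R (\<lambda>x. M * indicator (- C b) x)"
      using i2 i3 M by (intro integral_mono) (auto simp: indicator_def)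
    also have "\<dots> = M * measure_pmf.prob R (- C b)" by simp
    also have "measure_pmf.prob R (- C b) = 1 - measure_pmf.prob R (C b)"
      using measure_pmf.prob_compl[of "C b" R] by (simp add: Compl_eq_Diff_UNIV)
    finally show ?thesis .
  qed
  let ?h = "\<lambda>b n. M * (1 - (\<Sum>x\<in>C b. pmf (P n) x)) + M * (1 - measure_pmf.prob Q (C b)) +
    \<bar>(\<Sum>x\<in>C b. f x * pmf (P n) x) - (\<Sum>x\<in>C b. f x * pmf Q x)\<bar>"
  let ?H = "\<lambda>b. M * (1 - measure_pmf.prob Q (C b)) + M * (1 - measure_pmf.prob Q (C b))"
  have "(\<lambda>n. measure_pmf.expectation (P n) f - measure_pmf.expectation Q f) \<longlonglongrightarrow> 0"
  proof (rule tendsto_zero_two_scale[where h = ?h and H = ?H])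
    show "\<forall>\<^sub>F n in sequentially. \<bar>measure_pmf.expectation (P n) f - measure_pmf.expectation Q f\<bar> \<le> ?h b n" for b
    proof (rule always_eventually, rule allI)
      fix n
      show "\<bar>measure_pmf.expectation (P n) f - measure_pmf.expectation Q f\<bar> \<le> ?h b n"
        using split[of "P n" b] split[of Q b] C(1)[of b]
        by (simp add: measure_measure_pmf_finite[of "C b" "P n"])
    qed
    show "?h b \<longlonglongrightarrow> ?H b" for b
    proof -
      have "?h b \<longlonglongrightarrow> M * (1 - (\<Sum>x\<in>C b. pmf Q x)) + M * (1 - measure_pmf.prob Q (C b)) +
          \<bar>(\<Sum>x\<in>C b. f x * pmf Q x) - (\<Sum>x\<in>C b. f x * pmf Q x)\<bar>"
        by (intro tendsto_intros conv)
      then show ?thesis using C(1)[of b] by (simp add: measure_measure_pmf_finite)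
    qed
    have "?H \<longlonglongrightarrow> M * (1 - 1) + M * (1 - 1)" by (intro tendsto_intros C(2))
    then show "?H \<longlonglongrightarrow> 0" by simp
  qed
  then show ?thesis by (simp add: LIM_zero_iff)
qed

text \<open>Covers rate 0, which occurs if \<open>du = 1\<close> or \<open>dw = 1\<close>: there
  \<open>0 ^ 0 = 1\<close> gives the point mass.\<close>

lemma pmf_poisson_distribution:
  assumes "0 \<le> r"
  shows "pmf (poisson_distribution r) k = r ^ k / fact k * exp (- r)"
  using assms by (auto simp: poisson_distribution_def indicator_def)

locale poisson_rates =
  fixes L :: "'i set" and rate :: "'i \<Rightarrow> real"
  assumes finite_L: "finite L" and rate_nonneg: "\<And>c. c \<in> L \<Longrightarrow> 0 \<le> rate c"
begin

definition supported :: "('i \<Rightarrow> nat) \<Rightarrow> bool" where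
  "supported x \<longleftrightarrow> (\<forall>c. c \<notin> L \<longrightarrow> x c = 0)"

definition box :: "nat \<Rightarrow> ('i \<Rightarrow> nat) set" where
  "box b = {x. supported x \<and> (\<forall>c\<in>L. x c \<le> b)}"

definition total :: real where "total = (\<Sum>c\<in>L. rate c)"

text \<open>The price of a two-sided estimate: one \<open>e\<close> for the mean, at most one for
  every point of the box, and the rate times Markov's bound for the mass outside the box.\<close>

definition defect :: "nat \<Rightarrow> real \<Rightarrow> 'i \<Rightarrow> real" where
  "defect b e c = e * (1 + real (card (box b))) + rate c * ((total + real (card L) * e) / (real b + 1))"

abbreviation target :: "('i \<Rightarrow> nat) pmf" where
  "target \<equiv> Pi_pmf L 0 (\<lambda>c. poisson_distribution (rate c))"

lemma finite_box: "finite (box b)"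
proof -
  have "box b = PiE_dflt L 0 (\<lambda>_. {..b})"
    unfolding box_def supported_def PiE_dflt_def by auto
  then show ?thesis using finite_PiE_dflt[OF finite_L, of "\<lambda>_. {..b}" 0] by simp
qed

text \<open>The product of Poisson probabilities normalised to be 1 at the zero vector.\<close>

definition weight :: "('i \<Rightarrow> nat) \<Rightarrow> real" where
  "weight x = (\<Prod>c\<in>L. rate c ^ x c / fact (x c))"

lemma pmf_target:
  assumes "supported x"
  shows "pmf target x = exp (- total) * weight x"
proof -
  have "pmf target x = (\<Prod>c\<in>L. rate c ^ x c / fact (x c) * exp (- rate c))"
    using assms finite_L rate_nonneg
    by (subst pmf_Pi') (auto simp: supported_def pmf_poisson_distribution intro!: prod.cong)
  also have "\<dots> = weight x * (\<Prod>c\<in>L. exp (- rate c))" unfolding weight_def by (rule prod.distrib)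
  also have "(\<Prod>c\<in>L. exp (- rate c)) = exp (- total)"
    using finite_L by (simp add: total_def exp_sum[symmetric] sum_negf)
  finally show ?thesis by simp
qed

lemma weight_eq: "supported x \<Longrightarrow> weight x = exp total * pmf target x"
  by (simp add: pmf_target exp_minus)

lemma prob_box_tendsto:
  assumes "\<And>x. x \<in> set_pmf Q \<Longrightarrow> supported x"
  shows "(\<lambda>b. measure_pmf.prob Q (box b)) \<longlonglongrightarrow> 1"
proof -
  have "(\<lambda>b. measure_pmf.prob Q (box b)) \<longlonglongrightarrow> measure_pmf.prob Q (\<Union>b. box b)"
    by (intro measure_pmf.finite_Lim_measure_incseq)
      (auto simp: incseq_def box_def intro: order_trans)
  moreover have "x \<in> (\<Union>b. box b)" if "supported x" for x
    using that finite_L by (intro UN_I[of "\<Sum>c\<in>L. x c"]) (auto simp: box_def intro: member_le_sum)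
  then have "measure_pmf.prob Q (\<Union>b. box b) = 1"
    using assms by (subst measure_pmf.prob_eq_1) (auto simp: AE_measure_pmf_iff)
  ultimately show ?thesis by simp
qed

lemma set_target: "x \<in> set_pmf target \<Longrightarrow> supported x"
  using set_Pi_pmf_subset[OF finite_L] by (fastforce simp: supported_def)

text \<open>Stein's identity for the Poisson distribution, \<open>E (X g X) = r E (g (X + 1))\<close>, is used with
  \<open>g\<close> an indicator. It is assumed up to \<open>e\<close> in one direction only: the other direction
  follows because, summed over all \<open>x\<close>, the two sides differ by \<open>E X - r \<le> e\<close>.\<close>

context
  fixes Q :: "('i \<Rightarrow> nat) pmf" and e :: real
  assumes supp: "\<And>x. x \<in> set_pmf Q \<Longrightarrow> supported x" and e: "0 \<le> e"
    and int: "\<And>c. c \<in> L \<Longrightarrow> integrable (measure_pmf Q) (\<lambda>x. real (x c))"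
    and upper: "\<And>c. c \<in> L \<Longrightarrow> measure_pmf.expectation Q (\<lambda>x. real (x c)) \<le> rate c + e"
    and lower: "\<And>c x. c \<in> L \<Longrightarrow> supported x \<Longrightarrow>
      rate c * pmf Q x \<le> real (Suc (x c)) * pmf Q (x(c := Suc (x c))) + e"
begin

text \<open>Markov's inequality for the sum of the coordinates, which is at least
  \<open>b + 1\<close> outside the box.\<close>

lemma prob_outside_box: "1 - measure_pmf.prob Q (box b) \<le> (total + real (card L) * e) / (real b + 1)"
proof -
  let ?N = "\<lambda>x. \<Sum>c\<in>L. real (x c)"
  have i: "integrable (measure_pmf Q) ?N" using int by (intro Bochner_Integration.integrable_sum)
  have i': "integrable (measure_pmf Q) (\<lambda>x. 1 - indicator (box b) x :: real)"
    by (intro measure_pmf.integrable_const_bound[where B = 1]) (auto simp: indicator_def)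
  have "1 - indicator (box b) x \<le> ?N x / (real b + 1)" if x: "x \<in> set_pmf Q" for x
  proof (cases "x \<in> box b")
    case False
    then obtain c where c: "c \<in> L" "b < x c" using supp[OF x] by (auto simp: box_def not_le)
    have "real (x c) \<le> ?N x" using c finite_L by (intro member_le_sum) auto
    then have "real b + 1 \<le> ?N x" using c by linarith
    then show ?thesis using False by (simp add: field_simps)
  qed (auto intro!: sum_nonneg divide_nonneg_nonneg)
  then have "measure_pmf.expectation Q (\<lambda>x. 1 - indicator (box b) x) \<le> measure_pmf.expectation Q (\<lambda>x. ?N x / (real b + 1))"
    using i i' by (intro integral_mono_AE) (auto simp: AE_measure_pmf_iff)
  also have "\<dots> = measure_pmf.expectation Q ?N / (real b + 1)" by simp
  also have "\<dots> \<le> (total + real (card L) * e) / (real b + 1)"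
  proof (rule divide_right_mono)
    have "measure_pmf.expectation Q ?N = (\<Sum>c\<in>L. measure_pmf.expectation Q (\<lambda>x. real (x c)))"
      using int by (intro Bochner_Integration.integral_sum)
    also have "\<dots> \<le> (\<Sum>c\<in>L. rate c + e)" using upper by (intro sum_mono)
    also have "\<dots> = total + real (card L) * e" by (simp add: sum.distrib total_def)
    finally show "measure_pmf.expectation Q ?N \<le> total + real (card L) * e" .
  qed simp
  finally show ?thesis by (simp add: integrable_measure_pmf_bounded[where M = 1])
qed

abbreviation "bump c x \<equiv> x(c := Suc (x c))"

text \<open>Reindexed by the raised vectors, the left side is a part of the series for the
  mean.\<close>

lemma sum_bump_le:
  assumes "c \<in> L"
  shows "(\<Sum>x\<in>box b. real (Suc (x c)) * pmf Q (bump c x))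
    \<le> measure_pmf.expectation Q (\<lambda>x. real (x c))"
proof -
  have inj: "inj_on (bump c) (box b)"
  proof (rule inj_onI)
    fix x y :: "'i \<Rightarrow> nat" assume eq: "bump c x = bump c y"
    have "x i = y i" for i using fun_cong[OF eq, of i] by (cases "i = c") auto
    then show "x = y" by blast
  qed
  have "(\<Sum>x\<in>box b. real (Suc (x c)) * pmf Q (bump c x))
      = (\<Sum>y\<in>bump c ` box b. real (y c) * pmf Q y)"
    by (simp add: sum.reindex[OF inj])
  also have "\<dots> \<le> measure_pmf.expectation Q (\<lambda>x. real (x c))"
    using finite_box int[OF assms] by (intro sum_pmf_le_expectation) auto
  finally show ?thesis .
qed

lemma rate_prob_box:
  assumes "c \<in> L"
  shows "rate c - rate c * (\<Sum>x\<in>box b. pmf Q x) \<le> rate c * ((total + real (card L) * e) / (real b + 1))"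
proof -
  have "rate c * (1 - measure_pmf.prob Q (box b)) \<le> rate c * ((total + real (card L) * e) / (real b + 1))"
    using prob_outside_box rate_nonneg[OF assms] by (intro mult_left_mono)
  then show ?thesis using finite_box by (simp add: measure_measure_pmf_finite right_diff_distrib)
qed

lemma le_defect:
  assumes "c \<in> L"
  shows "e \<le> defect b e c"
proof -
  have "0 \<le> total" unfolding total_def using rate_nonneg by (intro sum_nonneg)
  then have "0 \<le> rate c * ((total + real (card L) * e) / (real b + 1))" "0 \<le> e * real (card (box b))"
    using e rate_nonneg[OF assms] by (auto intro!: mult_nonneg_nonneg divide_nonneg_nonneg add_nonneg_nonneg)
  then show ?thesis by (simp add: defect_def algebra_simps)
qed

lemma stein_defect:
  assumes "c \<in> L" "x \<in> box b"
  shows "\<bar>real (Suc (x c)) * pmf Q (bump c x) - rate c * pmf Q x\<bar> \<le> defect b e c"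
proof -
  define D where "D y = real (Suc (y c)) * pmf Q (bump c y) - rate c * pmf Q y" for y :: "'i \<Rightarrow> nat"
  have D_ge: "- e \<le> D y" if "y \<in> box b" for y
    using lower[OF assms(1), of y] that by (simp add: D_def box_def)
  \<comment> \<open>The total over the box is bounded through the mean, and every other point
    contributes at least \<open>- e\<close>. This leaves an upper bound for the single term at
    \<open>x\<close>.\<close>
  have "D x = (\<Sum>y\<in>box b. D y) - (\<Sum>y\<in>box b - {x}. D y)"
    using finite_box assms(2) by (simp add: sum.remove)
  moreover have "(\<Sum>y\<in>box b. D y) =
      (\<Sum>y\<in>box b. real (Suc (y c)) * pmf Q (bump c y)) - rate c * (\<Sum>y\<in>box b. pmf Q y)"
    by (simp add: D_def sum_subtractf sum_distrib_left)
  moreover have "(\<Sum>y\<in>box b - {x}. - D y) \<le> (\<Sum>y\<in>box b - {x}. e)"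
    using D_ge by (intro sum_mono) (auto simp: minus_le_iff)
  moreover have "(\<Sum>y\<in>box b - {x}. e) \<le> real (card (box b)) * e"
    using e finite_box by (simp add: mult_right_mono card_mono)
  ultimately have "D x \<le> rate c + e - rate c * (\<Sum>y\<in>box b. pmf Q y) + real (card (box b)) * e"
    using sum_bump_le[OF assms(1), of b] upper[OF assms(1)] by (simp add: sum_negf)
  then have "D x \<le> defect b e c"
    using rate_prob_box[OF assms(1), of b] by (simp add: defect_def algebra_simps)
  then show ?thesis using le_defect[OF assms(1), of b] D_ge[OF assms(2)] unfolding D_def by linarith
qed

text \<open>Summing the one-sided inequalities over the box also bounds the mean from below, so its
  convergence needs no further count of cycles.\<close>

lemma expectation_defect:
  assumes "c \<in> L"
  shows "\<bar>measure_pmf.expectation Q (\<lambda>x. real (x c)) - rate c\<bar> \<le> defect b e c"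
proof -
  have "rate c * (\<Sum>x\<in>box b. pmf Q x) - real (card (box b)) * e
      = (\<Sum>x\<in>box b. rate c * pmf Q x - e)"
    by (simp add: sum_subtractf sum_distrib_left)
  also have "\<dots> \<le> (\<Sum>x\<in>box b. real (Suc (x c)) * pmf Q (bump c x))"
    using lower[OF assms] by (intro sum_mono) (auto simp: box_def diff_le_eq)
  also note sum_bump_le[OF assms, of b]
  finally have "rate c - measure_pmf.expectation Q (\<lambda>x. real (x c)) \<le> defect b e c"
    using rate_prob_box[OF assms, of b] e by (simp add: defect_def algebra_simps)
  then show ?thesis using le_defect[OF assms, of b] upper[OF assms] by linarith
qed

end

lemma inverse_tendsto_zero: "(\<lambda>b. K / (real b + 1)) \<longlonglongrightarrow> 0"
  using tendsto_mult_right_zero[OF LIMSEQ_inverse_real_of_nat, of K] by (simp add: field_simps)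

lemma weight_bump:
  assumes "c \<in> L"
  shows "real (Suc (y c)) * weight (y(c := Suc (y c))) = rate c * weight y"
proof -
  let ?rest = "\<Prod>i\<in>L - {c}. rate i ^ y i / fact (y i)"
  have w: "weight y = rate c ^ y c / fact (y c) * ?rest"
    using assms finite_L by (simp add: weight_def prod.remove[of L c])
  have w': "weight (y(c := Suc (y c))) = rate c ^ Suc (y c) / fact (Suc (y c)) * ?rest"
    using assms finite_L by (simp add: weight_def prod.remove[of L c])
  have "real (Suc (y c)) * (rate c ^ Suc (y c) / fact (Suc (y c))) = rate c * (rate c ^ y c / fact (y c))"
    by (simp del: of_nat_Suc)
  then show ?thesis unfolding w w' by (simp only: mult.assoc[symmetric])
qed

section \<open>Convergence of a sequence of distributions with vanishing errors\<close>

context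
  fixes Q :: "nat \<Rightarrow> ('i \<Rightarrow> nat) pmf" and e :: "nat \<Rightarrow> real"
  assumes supp: "\<And>n x. x \<in> set_pmf (Q n) \<Longrightarrow> supported x" and e: "e \<longlonglongrightarrow> 0"
    and ev: "\<forall>\<^sub>F n in sequentially. 0 \<le> e n \<and> (\<forall>c\<in>L.
      integrable (measure_pmf (Q n)) (\<lambda>x. real (x c)) \<and>
      measure_pmf.expectation (Q n) (\<lambda>x. real (x c)) \<le> rate c + e n \<and>
      (\<forall>x. supported x \<longrightarrow> rate c * pmf (Q n) x \<le>
        real (Suc (x c)) * pmf (Q n) (x(c := Suc (x c))) + e n))"
begin

lemma defect_tendsto: "(\<lambda>n. defect b (e n) c) \<longlonglongrightarrow> rate c * total / (real b + 1)"
proof -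
  have "(\<lambda>n. defect b (e n) c) \<longlonglongrightarrow>
      0 * (1 + real (card (box b))) + rate c * ((total + real (card L) * 0) / (real b + 1))"
    unfolding defect_def by (intro tendsto_intros e) simp
  then show ?thesis by simp
qed

lemma expectation_tendsto_rate:
  assumes "c \<in> L"
  shows "(\<lambda>n. measure_pmf.expectation (Q n) (\<lambda>x. real (x c))) \<longlonglongrightarrow> rate c"
proof -
  have "(\<lambda>n. measure_pmf.expectation (Q n) (\<lambda>x. real (x c)) - rate c) \<longlonglongrightarrow> 0"
  proof (rule tendsto_zero_two_scale[OF _ defect_tendsto inverse_tendsto_zero])
    show "\<forall>\<^sub>F n in sequentially.
        \<bar>measure_pmf.expectation (Q n) (\<lambda>x. real (x c)) - rate c\<bar> \<le> defect b (e n) c" for b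
      using ev
    proof eventually_elim
      case (elim n)
      then show ?case by (intro expectation_defect supp assms) auto
    qed
  qed
  then show ?thesis by (simp add: LIM_zero_iff)
qed

lemma stein_tendsto:
  assumes "c \<in> L" "supported x"
  shows "(\<lambda>n. real (Suc (x c)) * pmf (Q n) (x(c := Suc (x c))) - rate c * pmf (Q n) x) \<longlonglongrightarrow> 0"
proof (rule tendsto_zero_two_scale[OF _ defect_tendsto
      LIMSEQ_ignore_initial_segment[OF inverse_tendsto_zero, where k = "\<Sum>c\<in>L. x c"]])
  fix b
  \<comment> \<open>The scale is shifted by the sum of the coordinates so that \<open>x\<close> lies
    in every box considered.\<close>
  have "x \<in> box (b + (\<Sum>c\<in>L. x c))"
    using assms(2) member_le_sum[of _ L x] finite_L by (auto simp: box_def intro!: trans_le_add2)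
  from ev show "\<forall>\<^sub>F n in sequentially.
      \<bar>real (Suc (x c)) * pmf (Q n) (x(c := Suc (x c))) - rate c * pmf (Q n) x\<bar>
        \<le> defect (b + (\<Sum>c\<in>L. x c)) (e n) c"
  proof eventually_elim
    case (elim n)
    then show ?case using \<open>x \<in> box _\<close> by (intro stein_defect supp assms) auto
  qed
qed

text \<open>\<open>weight\<close> satisfies the Stein recursion exactly, the distributions
  \<open>Q n\<close> satisfy it in the limit, and both sides agree at the zero vector. Induction on
  the sum of the coordinates leaves only the probability of the zero vector undetermined.\<close>

lemma pmf_ratio_tendsto:
  assumes "supported x"
  shows "(\<lambda>n. pmf (Q n) x - pmf (Q n) (\<lambda>_. 0) * weight x) \<longlonglongrightarrow> 0"
  using assms
proof (induction "\<Sum>c\<in>L. x c" arbitrary: x)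
  case 0
  then have "x = (\<lambda>_. 0)" using finite_L by (auto simp: supported_def)
  then show ?case by (simp add: weight_def)
next
  case (Suc s)
  then obtain c where c: "c \<in> L" "x c \<noteq> 0" using finite_L by (metis nat.distinct(1) sum.neutral)
  define y where "y = x(c := x c - 1)"
  have x: "x = y(c := Suc (y c))" using c(2) by (auto simp: y_def)
  have supp_y: "supported y" using Suc.prems c(1) by (auto simp: supported_def y_def)
  have "(\<Sum>i\<in>L. x i) = Suc (\<Sum>i\<in>L. y i)"
    using finite_L c(1) by (subst x) (simp add: sum.remove[of L c])
  then have IH: "(\<lambda>n. pmf (Q n) y - pmf (Q n) (\<lambda>_. 0) * weight y) \<longlonglongrightarrow> 0"
    using Suc.hyps supp_y by simp
  have "pmf (Q n) x - pmf (Q n) (\<lambda>_. 0) * weight x =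
      ((real (Suc (y c)) * pmf (Q n) x - rate c * pmf (Q n) y) +
        rate c * (pmf (Q n) y - pmf (Q n) (\<lambda>_. 0) * weight y)) / real (Suc (y c))" for n
  proof -
    define S where "S = real (Suc (y c))"
    have "rate c * weight y = S * weight x" using weight_bump[OF c(1), of y] x by (simp add: S_def)
    then have "rate c * (pmf (Q n) (\<lambda>_. 0) * weight y) = S * (pmf (Q n) (\<lambda>_. 0) * weight x)"
      by (metis mult.left_commute)
    then have "(S * pmf (Q n) x - rate c * pmf (Q n) y) +
        rate c * (pmf (Q n) y - pmf (Q n) (\<lambda>_. 0) * weight y) =
        S * (pmf (Q n) x - pmf (Q n) (\<lambda>_. 0) * weight x)"
      by (simp add: right_diff_distrib)
    moreover have "S \<noteq> 0" by (simp add: S_def)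
    ultimately show ?thesis unfolding S_def[symmetric] by simp
  qed
  moreover have "(\<lambda>n. ((real (Suc (y c)) * pmf (Q n) x - rate c * pmf (Q n) y) +
        rate c * (pmf (Q n) y - pmf (Q n) (\<lambda>_. 0) * weight y)) / real (Suc (y c)))
      \<longlonglongrightarrow> (0 + rate c * 0) / real (Suc (y c))"
    using stein_tendsto[OF c(1) supp_y] IH unfolding x[symmetric] by (intro tendsto_intros) auto
  ultimately show ?case by simp
qed

text \<open>Total mass 1 fixes the remaining constant: a large box carries nearly all mass of
  \<open>Q n\<close> and of \<open>target\<close>, and on the box both are nearly proportional to
  \<open>weight\<close>.\<close>

lemma pmf_zero_tendsto: "(\<lambda>n. pmf (Q n) (\<lambda>_. 0) * exp total) \<longlonglongrightarrow> 1"
proof -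
  let ?p = "\<lambda>b. measure_pmf.prob target (box b)"
  let ?r = "\<lambda>n x. pmf (Q n) x - pmf (Q n) (\<lambda>_. 0) * weight x"
  let ?h = "\<lambda>b n. (total + real (card L) * e n) / (real b + 1) + \<bar>\<Sum>x\<in>box b. ?r n x\<bar> +
    exp total * (1 - ?p b)"
  let ?H = "\<lambda>b. total / (real b + 1) + exp total * (1 - ?p b)"
  have weight_sum: "(\<Sum>x\<in>box b. weight x) = exp total * ?p b" for b
    using finite_box[of b]
    by (auto simp: measure_measure_pmf_finite weight_eq box_def sum_distrib_left intro!: sum.cong)
  have "(\<lambda>n. pmf (Q n) (\<lambda>_. 0) * exp total - 1) \<longlonglongrightarrow> 0"
  proof (rule tendsto_zero_two_scale[where h = ?h and H = ?H])
    fix b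
    from ev show "\<forall>\<^sub>F n in sequentially. \<bar>pmf (Q n) (\<lambda>_. 0) * exp total - 1\<bar> \<le> ?h b n"
    proof eventually_elim
      case (elim n)
      let ?a = "pmf (Q n) (\<lambda>_. 0)"
      have "1 - measure_pmf.prob (Q n) (box b) \<le> (total + real (card L) * e n) / (real b + 1)"
        using elim by (intro prob_outside_box supp) auto
      moreover have "measure_pmf.prob (Q n) (box b) = (\<Sum>x\<in>box b. ?r n x) + ?a * (exp total * ?p b)"
        unfolding weight_sum[symmetric]
        by (simp add: sum_subtractf sum_distrib_left
            measure_measure_pmf_finite[OF finite_box, of "Q n"])
      moreover have "0 \<le> ?a * (exp total * (1 - ?p b))" by simp
      moreover have "?a * (exp total * (1 - ?p b)) \<le> exp total * (1 - ?p b)"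
        by (intro mult_left_le_one_le) (auto simp: pmf_le_1)
      moreover have "?a * (exp total * (1 - ?p b)) = ?a * exp total - ?a * (exp total * ?p b)"
        by (simp add: algebra_simps)
      moreover have "measure_pmf.prob (Q n) (box b) \<le> 1" by simp
      ultimately show ?case by linarith
    qed
    have "?h b \<longlonglongrightarrow> (total + real (card L) * 0) / (real b + 1) + \<bar>\<Sum>x\<in>box b. 0\<bar> + exp total * (1 - ?p b)"
      by (intro tendsto_intros e pmf_ratio_tendsto) (auto simp: box_def)
    then show "?h b \<longlonglongrightarrow> ?H b" by simp
  next
    have "?H \<longlonglongrightarrow> 0 + exp total * (1 - 1)"
      by (intro tendsto_intros inverse_tendsto_zero prob_box_tendsto set_target)
    then show "?H \<longlonglongrightarrow> 0" by simp
  qed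
  then show ?thesis by (simp add: LIM_zero_iff)
qed

lemma pmf_tendsto_target: "(\<lambda>n. pmf (Q n) x) \<longlonglongrightarrow> pmf target x"
proof (cases "supported x")
  case True
  have "(\<lambda>n. (pmf (Q n) x - pmf (Q n) (\<lambda>_. 0) * weight x) +
      pmf (Q n) (\<lambda>_. 0) * exp total * pmf target x) \<longlonglongrightarrow> 0 + 1 * pmf target x"
    by (intro tendsto_intros pmf_ratio_tendsto pmf_zero_tendsto True)
  then show ?thesis using True by (simp add: weight_eq)
next
  case False
  then have "pmf (Q n) x = 0" "pmf target x = 0" for n
    using supp set_target by (meson pmf_eq_0_set_pmf)+
  then show ?thesis by simp
qed

end

end

section \<open>Random biregular bipartite graphs\<close>

context biregular_sides begin

text \<open>Enumerate the two sides and join edge number \<open>t < m\<close> to the nodes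
  \<open>t div du\<close> and \<open>t mod |W|\<close>.\<close>

lemma graphs_nonempty:
  assumes "dw \<le> card U" "du \<le> card W"
  shows "\<G> \<noteq> {}"
proof -
  let ?b = "card W"
  have b: "0 < ?b" using assms degrees_pos by linarith
  obtain f g where f: "bij_betw f {0..<card U} U" and g: "bij_betw g {0..<?b} W"
    using finite_sides ex_bij_betw_nat_finite by blast
  have m_eq: "m = card U * du" "m = ?b * dw" using balanced by (simp_all add: m_def)
  define edge where "edge t = {f (t div du), g (t mod ?b)}" for t
  have left: "t div du < card U" if "t < m" for t
    using that m_eq(1) degrees_pos by (simp add: less_mult_imp_div_less)
  have right: "t mod ?b < ?b" for t using b by simp
  have fU: "f (t div du) \<in> U" if "t < m" for t using left[OF that] f by (auto simp: bij_betw_def)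
  have gW: "g (t mod ?b) \<in> W" for t using right[of t] g by (auto simp: bij_betw_def)
  have edge_iff: "f i \<in> edge t \<longleftrightarrow> t div du = i" "g j \<in> edge t \<longleftrightarrow> t mod ?b = j"
    if "t < m" "i < card U" "j < ?b" for t i j
  proof -
    have "f i \<in> U" "g j \<in> W" using bij_betwE[OF f] bij_betwE[OF g] that(2,3) by simp_all
    then have "f i \<noteq> g (t mod ?b)" "g j \<noteq> f (t div du)"
      using fU[OF that(1)] gW[of t] disjoint_sides by (metis disjoint_iff)+
    then have "f i \<in> edge t \<longleftrightarrow> f (t div du) = f i" "g j \<in> edge t \<longleftrightarrow> g (t mod ?b) = g j"
      unfolding edge_def by (metis insert_iff empty_iff)+
    moreover have "f (t div du) = f i \<longleftrightarrow> t div du = i" "g (t mod ?b) = g j \<longleftrightarrow> t mod ?b = j"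
      using left[OF that(1)] right[of t] that
      by (simp_all add: inj_on_eq_iff[OF bij_betw_imp_inj_on[OF f]]
          inj_on_eq_iff[OF bij_betw_imp_inj_on[OF g]])
    ultimately show "f i \<in> edge t \<longleftrightarrow> t div du = i" "g j \<in> edge t \<longleftrightarrow> t mod ?b = j"
      by simp_all
  qed
  have inj: "inj_on edge {..<m}"
  proof (rule inj_onI)
    fix t t' assume t: "t \<in> {..<m}" "t' \<in> {..<m}" "edge t = edge t'"
    have "f (t div du) \<in> edge t'" "g (t mod ?b) \<in> edge t'" using t(3) by (auto simp: edge_def)
    then have eq: "t' div du = t div du" "t' mod ?b = t mod ?b"
      using edge_iff[of t' "t div du" "t mod ?b"] t left right by auto
    \<comment> \<open>No parallel edges: two numbers with the same quotient by \<open>du\<close>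
      differ by less than \<open>du\<close>, hence by less than \<open>card W\<close>, so congruence
      modulo \<open>card W\<close> forces equality.\<close>
    have "t = t'" if "t \<le> t'" "t' div du = t div du" "t' mod ?b = t mod ?b" for t t'
    proof -
      define s where "s = t div du * du"
      have "t' mod du < du" "t' = s + t' mod du" "t = s + t mod du"
        using degrees_pos div_mult_mod_eq[of t' du] div_mult_mod_eq[of t du] that(2)
        by (simp_all add: s_def)
      then have "t' - t < ?b" using assms(2) by linarith
      moreover have "?b dvd t' - t" using that(1,3) by (metis mod_eq_dvd_iff_nat)
      ultimately have "t' - t = 0" using nat_dvd_not_less by blast
      then show ?thesis using that(1) by simp
    qed
    then show "t = t'" using eq by (metis nat_le_linear)
  qed
  let ?E = "edge ` {..<m}"
  have degree: "node_degree ?E v = card {t \<in> {..<m}. v \<in> edge t}" for v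
  proof -
    have "{e \<in> ?E. v \<in> e} = edge ` {t \<in> {..<m}. v \<in> edge t}" by auto
    moreover have "inj_on edge {t \<in> {..<m}. v \<in> edge t}" using inj by (rule inj_on_subset) auto
    ultimately show ?thesis by (simp add: node_degree_def card_image)
  qed
  have "node_degree ?E u = du" if "u \<in> U" for u
  proof -
    have "u \<in> f ` {0..<card U}" using that by (simp only: bij_betw_imp_surj_on[OF f])
    then obtain i where i: "i < card U" "u = f i" by auto
    have "{t \<in> {..<m}. u \<in> edge t} = {t \<in> {..<m}. t div du = i}"
      using edge_iff(1) i b by blast
    also have "\<dots> = {i * du..<i * du + du}"
    proof (intro set_eqI iffI)
      fix t assume "t \<in> {i * du..<i * du + du}"
      then have t: "i * du \<le> t" "t < Suc i * du" by auto
      then have "t div du = i" by (intro div_nat_eqI) (simp_all add: mult.commute)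
      moreover have "Suc i * du \<le> m" using i(1) m_eq(1) by (metis Suc_leI mult_le_mono1)
      ultimately show "t \<in> {t \<in> {..<m}. t div du = i}" using t by simp
    qed (use degrees_pos in \<open>auto simp: dividend_less_div_times add.commute\<close>)
    finally show ?thesis using degree by simp
  qed
  moreover have "node_degree ?E w = dw" if "w \<in> W" for w
  proof -
    have "w \<in> g ` {0..<?b}" using that by (simp only: bij_betw_imp_surj_on[OF g])
    then obtain j where j: "j < ?b" "w = g j" by auto
    have "{t \<in> {..<m}. w \<in> edge t} = {t \<in> {..<m}. t mod ?b = j}"
      using edge_iff(2)[of _ "_ div du"] left j by blast
    also have "\<dots> = (\<lambda>s. s * ?b + j) ` {..<dw}"
    proof (intro set_eqI iffI)
      fix t assume "t \<in> {t \<in> {..<m}. t mod ?b = j}"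
      then have "t = t div ?b * ?b + j" "t div ?b < dw"
        using m_eq(2) by (auto simp: less_mult_imp_div_less mult.commute)
      then show "t \<in> (\<lambda>s. s * ?b + j) ` {..<dw}" by blast
    next
      fix t assume "t \<in> (\<lambda>s. s * ?b + j) ` {..<dw}"
      then obtain s where s: "s < dw" "t = s * ?b + j" by auto
      have "t < Suc s * ?b" using s j by simp
      also have "\<dots> \<le> m" using s(1) m_eq(2) by (metis Suc_leI mult.commute mult_le_mono1)
      finally show "t \<in> {t \<in> {..<m}. t mod ?b = j}" using s j by simp
    qed
    also have "card \<dots> = dw" using b by (subst card_image) (auto simp: inj_on_def)
    finally show ?thesis using degree by simp
  qed
  moreover have "?E \<subseteq> {{u, w} | u w. u \<in> U \<and> w \<in> W}" using fU gW by (auto simp: edge_def)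
  ultimately have "?E \<in> \<G>" unfolding biregular_bipartite_graphs_def by blast
  then show ?thesis by blast
qed

section \<open>Cycle counts under the uniform distribution\<close>

abbreviation random_graph :: "'a set set pmf" where
  "random_graph \<equiv> random_biregular_bipartite_graph U W du dw"

lemma expectation_num_cycles:
  assumes "\<G> \<noteq> {}"
  shows "measure_pmf.expectation random_graph (\<lambda>E. real (num_cycles c E)) =
    real (\<Sum>E\<in>\<G>. num_cycles c E) / real (card \<G>)"
  using assms finite_graphs
  by (simp add: random_biregular_bipartite_graph_def integral_pmf_of_set)

lemma expectation_num_cycles_le:
  assumes "\<G> \<noteq> {}"
  shows "measure_pmf.expectation random_graph (\<lambda>E. real (num_cycles c E)) * real (c * (m - collisions c))
    \<le> real (m * growth c)"
proof -
  have "0 < card \<G>" using assms finite_graphs by (simp add: card_gt_0_iff)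
  moreover have "real ((\<Sum>E\<in>\<G>. num_cycles c E) * (c * (m - collisions c))) \<le> real (card \<G> * (m * growth c))"
    using sum_num_cycles_le by (rule of_nat_mono)
  ultimately show ?thesis
    unfolding expectation_num_cycles[OF assms] by (simp only: of_nat_mult) (simp add: field_simps)
qed

text \<open>A crude bound, used for all lengths up to \<open>2 * k + 2\<close> in order to control
  the roots that are not tree-like.\<close>

lemma expectation_num_cycles_bounded:
  assumes "\<G> \<noteq> {}" "2 * collisions c < m" "0 < c"
  shows "measure_pmf.expectation random_graph (\<lambda>E. real (num_cycles c E)) \<le> 2 * real (growth c)"
proof -
  let ?e = "measure_pmf.expectation random_graph (\<lambda>E. real (num_cycles c E))"
  have "0 \<le> ?e" by (intro Bochner_Integration.integral_nonneg) simp
  have "m \<le> 2 * (c * (m - collisions c))"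
  proof -
    have "m \<le> 2 * (m - collisions c)" using assms(2) by linarith
    also have "\<dots> \<le> 2 * (c * (m - collisions c))" using assms(3) by simp
    finally show ?thesis .
  qed
  then have "real m \<le> 2 * real (c * (m - collisions c))" by linarith
  then have "?e * real m \<le> ?e * (2 * real (c * (m - collisions c)))"
    using \<open>0 \<le> ?e\<close> by (rule mult_left_mono)
  also have "\<dots> = 2 * (?e * real (c * (m - collisions c)))" by (rule mult.left_commute)
  also have "\<dots> \<le> 2 * real (m * growth c)"
    using expectation_num_cycles_le[OF assms(1)] by (intro mult_left_mono) auto
  finally show ?thesis using assms(2) by (simp add: field_simps)
qed

definition cycle_counts :: "nat \<Rightarrow> 'a set set \<Rightarrow> nat \<Rightarrow> nat" where
  "cycle_counts k E c = (if c \<in> cycle_lengths k then num_cycles c E else 0)"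

lemma pmf_cycle_counts:
  assumes "\<G> \<noteq> {}"
  shows "pmf (map_pmf (cycle_counts k) random_graph) x =
    real (card {E \<in> \<G>. cycle_counts k E = x}) / real (card \<G>)"
proof -
  have "pmf (map_pmf (cycle_counts k) random_graph) x =
      measure_pmf.prob random_graph {E. cycle_counts k E = x}"
    by (simp add: pmf_map vimage_def)
  also have "\<dots> = real (card (\<G> \<inter> {E. cycle_counts k E = x})) / real (card \<G>)"
    using assms finite_graphs
    by (simp add: random_biregular_bipartite_graph_def measure_pmf_of_set)
  also have "\<G> \<inter> {E. cycle_counts k E = x} = {E \<in> \<G>. cycle_counts k E = x}" by blast
  finally show ?thesis .
qed

text \<open>Bounds the mean number of unusable walks: the mean number of cycles of length up to
  \<open>R\<close>, times bad roots for each cycle, times walks from each root. The exponent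
  \<open>Suc k\<close> serves all \<open>c \<le> k\<close> at once.\<close>

definition walk_error :: "nat \<Rightarrow> nat" where
  "walk_error k = (let R = 2 * k + 2 in
     (\<Sum>j=3..R. 2 * growth j) * (R * (R * deg ^ R)) * deg ^ Suc k)"

lemma cycle_counts_recursion:
  assumes ne: "\<G> \<noteq> {}" and large: "\<forall>j\<le>2 * k + 2. 2 * collisions j < m"
    and c: "c \<in> cycle_lengths k"
  shows "real (growth c) * pmf (map_pmf (cycle_counts k) random_graph) x
    \<le> real c * (real (Suc (x c)) * pmf (map_pmf (cycle_counts k) random_graph) (x(c := Suc (x c))))
      + real (walk_error k) / real m"
proof -
  define R where "R = 2 * k + 2"
  define K where "K = R * (R * deg ^ R) * deg ^ Suc k"
  have error: "walk_error k = (\<Sum>j=3..R. 2 * growth j) * K"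
    unfolding walk_error_def Let_def K_def R_def by (simp only: mult.assoc)
  define A where "A = {E \<in> \<G>. cycle_counts k E = x}"
  define B where "B = {E \<in> \<G>. cycle_counts k E = x(c := Suc (x c))}"
  have c': "even c" "3 \<le> c" "c \<le> k" using c by (auto simp: cycle_lengths_def)
  have m: "0 < m" using large by auto
  have g: "0 < card \<G>" using ne finite_graphs by (simp add: card_gt_0_iff)
  have fin: "finite A" "A \<subseteq> \<G>" "B \<subseteq> \<G>" using finite_graphs by (auto simp: A_def B_def)
  have split: "m * growth c = card {q \<in> nb_walks E c. tree_like R E (hd q)} +
      card {q \<in> nb_walks E c. \<not> tree_like R E (hd q)}" if "E \<in> \<G>" for E
  proof -
    have "nb_walks E c = {q \<in> nb_walks E c. tree_like R E (hd q)} \<union>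
        {q \<in> nb_walks E c. \<not> tree_like R E (hd q)}" by blast
    then have "card (nb_walks E c) = card {q \<in> nb_walks E c. tree_like R E (hd q)} +
        card {q \<in> nb_walks E c. \<not> tree_like R E (hd q)}"
      using card_nb_walks[OF that] by (subst card_Un_disjoint[symmetric]) auto
    then show ?thesis using card_nb_walks[OF that] by simp
  qed
  have deg1: "1 \<le> deg" using degrees_pos by (simp add: deg_def)
  have bad: "card {q \<in> nb_walks E c. \<not> tree_like R E (hd q)} \<le> (\<Sum>j=3..R. num_cycles j E) * K"
    if "E \<in> \<G>" for E
  proof -
    have "card {q \<in> nb_walks E c. \<not> tree_like R E (hd q)}
        \<le> (\<Sum>j=3..R. num_cycles j E) * (R * (R * deg ^ R)) * deg ^ Suc c"
      by (rule card_not_tree_like_walks[OF that])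
    also have "\<dots> \<le> (\<Sum>j=3..R. num_cycles j E) * (R * (R * deg ^ R)) * deg ^ Suc k"
      using c' deg1 by (intro mult_left_mono power_increasing) auto
    finally show ?thesis by (simp add: K_def mult.assoc)
  qed
  have good: "(\<Sum>E\<in>A. card {q \<in> nb_walks E c. tree_like R E (hd q)})
      \<le> (\<Sum>F\<in>B. num_cycles c F) * (c * m)"
    unfolding R_def
  proof (rule sum_tree_like_walks_le[OF c' fin(2,3)])
    fix E F assume EF: "E \<in> A" "F \<in> \<G>"
      "\<forall>j\<le>k. num_cycles j F = num_cycles j E + (if j = c then 1 else 0)"
    have "cycle_counts k F = (cycle_counts k E)(c := Suc (cycle_counts k E c))"
      using EF(3) c by (auto simp: cycle_counts_def cycle_lengths_def)
    then show "F \<in> B" using EF by (simp add: A_def B_def)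
  qed
  have "num_cycles c F = Suc (x c)" if "F \<in> B" for F
    using that c by (auto simp: B_def cycle_counts_def dest: fun_cong[where x = c])
  then have good': "(\<Sum>F\<in>B. num_cycles c F) = card B * Suc (x c)" by simp
  have "card A * (m * growth c) = (\<Sum>E\<in>A. m * growth c)" by simp
  also have "\<dots> = (\<Sum>E\<in>A. card {q \<in> nb_walks E c. tree_like R E (hd q)} +
      card {q \<in> nb_walks E c. \<not> tree_like R E (hd q)})"
    using fin(2) by (intro sum.cong refl split) blast
  also have "\<dots> \<le> card B * Suc (x c) * (c * m) + (\<Sum>E\<in>A. (\<Sum>j=3..R. num_cycles j E) * K)"
    unfolding sum.distrib using good bad fin(2) unfolding good' by (intro add_mono sum_mono) auto
  \<comment> \<open>Means of cycle counts are controlled over all graphs, not over \<open>A\<close>.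
    The enlarged sum is still at most a constant times \<open>card \<G>\<close>, so after division
    by \<open>m * card \<G>\<close> it is O(1/m) for every \<open>x\<close>.\<close>
  also have "\<dots> \<le> card B * Suc (x c) * (c * m) + (\<Sum>E\<in>\<G>. (\<Sum>j=3..R. num_cycles j E) * K)"
    using fin(2) finite_graphs by (intro add_left_mono sum_mono2) auto
  also have "(\<Sum>E\<in>\<G>. (\<Sum>j=3..R. num_cycles j E) * K) = (\<Sum>j=3..R. \<Sum>E\<in>\<G>. num_cycles j E) * K"
    by (subst sum.swap) (simp add: sum_distrib_right)
  finally have "real (card A * (m * growth c)) \<le>
      real (card B * Suc (x c) * (c * m) + (\<Sum>j=3..R. \<Sum>E\<in>\<G>. num_cycles j E) * K)"
    by (rule of_nat_mono)
  also have "\<dots> = real (card B * Suc (x c) * (c * m)) + (\<Sum>j=3..R. real (\<Sum>E\<in>\<G>. num_cycles j E)) * real K"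
    by simp
  also have "\<dots> \<le> real (card B * Suc (x c) * (c * m)) + (\<Sum>j=3..R. 2 * real (growth j) * real (card \<G>)) * real K"
  proof (intro add_left_mono mult_right_mono sum_mono)
    fix j assume "j \<in> {3..R}"
    then have "measure_pmf.expectation random_graph (\<lambda>E. real (num_cycles j E)) \<le> 2 * real (growth j)"
      using large by (intro expectation_num_cycles_bounded ne) (auto simp: R_def)
    then show "real (\<Sum>E\<in>\<G>. num_cycles j E) \<le> 2 * real (growth j) * real (card \<G>)"
      using g unfolding expectation_num_cycles[OF ne] by (simp only: pos_divide_le_eq of_nat_0_less_iff)
  qed simp
  also have "(\<Sum>j=3..R. 2 * real (growth j) * real (card \<G>)) = real (card \<G>) * (\<Sum>j=3..R. 2 * real (growth j))"
    by (simp add: sum_distrib_left mult_ac)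
  finally have "real (card A) * (real m * real (growth c)) \<le>
      real (card B) * real (Suc (x c)) * (real c * real m) + real (card \<G>) * real (walk_error k)"
    by (simp only: error of_nat_mult of_nat_sum of_nat_numeral mult_ac)
  moreover have "0 < real m" "0 < real (card \<G>)" using m g by simp_all
  ultimately show ?thesis
    unfolding pmf_cycle_counts[OF ne] A_def[symmetric] B_def[symmetric]
    by (simp add: field_simps del: of_nat_Suc)
qed

end

context biregular_sides begin

text \<open>Converts growth of the number of nodes into growth of \<open>m\<close>; degrees are
  positive, so neither side has more nodes than there are edges.\<close>

lemma card_nodes_le: "card (U \<union> W) \<le> 2 * m"
proof -
  have "card U \<le> card U * du" "card W \<le> card W * dw" using degrees_pos by simp_all
  then have "card U \<le> m" "card W \<le> m" unfolding m_def balanced[symmetric] .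
  then show ?thesis using card_Un_le[of U W] by linarith
qed

lemma growth_cycle_mean:
  assumes "c \<in> cycle_lengths k"
  shows "real (growth c) = real c * cycle_mean du dw c"
proof -
  have "Suc c div 2 = c div 2" "c \<noteq> 0" using assms by (auto simp: cycle_lengths_def)
  then show ?thesis using degrees_pos
    by (simp add: growth_def cycle_mean_def power_mult_distrib of_nat_diff)
qed

lemma cycle_mean_nonneg: "0 \<le> cycle_mean du dw c"
  using degrees_pos by (simp add: cycle_mean_def)

text \<open>One error serving all lengths. The quotient comes from \<open>m / (m - collisions c) = 1
  + collisions c / (m - collisions c)\<close>, and \<open>growth c\<close> dominates the mean
  because it is \<open>c\<close> times as large.\<close>

definition approximation_error :: "nat \<Rightarrow> real" where
  "approximation_error k =
     (\<Sum>c\<in>cycle_lengths k. real (growth c) * (real (collisions c) / (real m - real (collisions c))))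
     + real (walk_error k) / real m"

lemma finite_cycle_lengths: "finite (cycle_lengths k)"
  by (rule finite_subset[of _ "{..k}"]) (auto simp: cycle_lengths_def)

context
  fixes k :: nat
  assumes ne: "\<G> \<noteq> {}" and large: "\<forall>j\<le>2 * k + 2. 2 * collisions j < m"
begin

lemma approximation_error_nonneg:
  assumes "c \<in> cycle_lengths k"
  shows "real (growth c) * (real (collisions c) / (real m - real (collisions c))) \<le> approximation_error k"
    "real (walk_error k) / real m \<le> approximation_error k" "0 \<le> approximation_error k"
proof -
  let ?t = "\<lambda>c. real (growth c) * (real (collisions c) / (real m - real (collisions c)))"
  have t: "0 \<le> ?t j" if "j \<in> cycle_lengths k" for j
    using large[rule_format, of j] that by (auto simp: cycle_lengths_def intro!: mult_nonneg_nonneg divide_nonneg_nonneg)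
  then have s: "?t c \<le> (\<Sum>j\<in>cycle_lengths k. ?t j)" "0 \<le> (\<Sum>j\<in>cycle_lengths k. ?t j)"
    using assms finite_cycle_lengths by (auto intro!: member_le_sum sum_nonneg)
  have w: "0 \<le> real (walk_error k) / real m" by simp
  show "?t c \<le> approximation_error k" "real (walk_error k) / real m \<le> approximation_error k"
    "0 \<le> approximation_error k"
    unfolding approximation_error_def using s w by linarith+
qed

lemma cycle_counts_mean_le:
  assumes c: "c \<in> cycle_lengths k"
  shows "measure_pmf.expectation random_graph (\<lambda>E. real (num_cycles c E))
    \<le> cycle_mean du dw c + approximation_error k"
proof -
  let ?e = "measure_pmf.expectation random_graph (\<lambda>E. real (num_cycles c E))"
  have c1: "1 \<le> real c" and lt: "2 * collisions c < m"
    using c large by (auto simp: cycle_lengths_def)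
  let ?d = "real m - real (collisions c)"
  have d: "0 < ?d" using lt by linarith
  have "real (m - collisions c) = ?d" using lt by (simp add: of_nat_diff)
  then have "real c * (?e * ?d) \<le> real c * (real m * cycle_mean du dw c)"
    using expectation_num_cycles_le[OF ne, of c] growth_cycle_mean[OF c]
    by (simp add: mult_ac)
  then have "?e * ?d \<le> real m * cycle_mean du dw c" using c1 by (simp add: mult_le_cancel_left)
  then have "?e \<le> real m * cycle_mean du dw c / ?d" using d by (simp add: pos_le_divide_eq)
  also have "\<dots> = cycle_mean du dw c + cycle_mean du dw c * (real (collisions c) / ?d)"
    using d by (simp add: field_simps)
  also have "cycle_mean du dw c * (real (collisions c) / ?d) \<le> real (growth c) * (real (collisions c) / ?d)"
  proof (rule mult_right_mono)
    show "cycle_mean du dw c \<le> real (growth c)"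
      using mult_right_mono[OF c1 cycle_mean_nonneg] growth_cycle_mean[OF c] by simp
  qed (use d in simp)
  finally show ?thesis using approximation_error_nonneg(1)[OF c] by linarith
qed

lemma cycle_counts_stein:
  assumes c: "c \<in> cycle_lengths k"
  shows "cycle_mean du dw c * pmf (map_pmf (cycle_counts k) random_graph) x
    \<le> real (Suc (x c)) * pmf (map_pmf (cycle_counts k) random_graph) (x(c := Suc (x c)))
      + approximation_error k"
proof -
  let ?p = "pmf (map_pmf (cycle_counts k) random_graph)"
  have c1: "1 \<le> real c" using c by (auto simp: cycle_lengths_def)
  have "real c * (cycle_mean du dw c * ?p x)
      \<le> real c * (real (Suc (x c)) * ?p (x(c := Suc (x c)))) + real (walk_error k) / real m"
    using cycle_counts_recursion[OF ne large c, of x] growth_cycle_mean[OF c] by (simp only: mult.assoc)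
  also have "real (walk_error k) / real m \<le> approximation_error k"
    by (rule approximation_error_nonneg[OF c])
  also have "approximation_error k \<le> real c * approximation_error k"
    using mult_right_mono[OF c1 approximation_error_nonneg(3)[OF c]] by simp
  finally have "real c * (cycle_mean du dw c * ?p x)
      \<le> real c * (real (Suc (x c)) * ?p (x(c := Suc (x c))) + approximation_error k)"
    by (simp only: distrib_left)
  then show ?thesis using c1 by (simp only: mult_le_cancel_left)
qed

end

end

theorem corollary1:
  fixes du dw k :: nat and U W :: "nat \<Rightarrow> 'a set"
  assumes "0 < du" and "0 < dw"
    and "even k" and "4 \<le> k"
    and "\<And>n. finite (U n)" and "\<And>n. finite (W n)" and "\<And>n. U n \<inter> W n = {}"
    and "\<And>n. card (U n) * du = card (W n) * dw"
    and "filterlim (\<lambda>n. card (U n \<union> W n)) at_top sequentially"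
  shows "converges_in_distribution
           (\<lambda>n. map_pmf (cycle_vector k) (random_biregular_bipartite_graph (U n) (W n) du dw))
           (Pi_pmf (cycle_lengths k) 0
              (\<lambda>c. map_pmf real (poisson_distribution (cycle_mean du dw c))))
         \<and> (\<forall>c \<in> cycle_lengths k.
              (\<lambda>n. measure_pmf.expectation
                     (random_biregular_bipartite_graph (U n) (W n) du dw)
                     (\<lambda>E. real (num_cycles c E)))
              \<longlonglongrightarrow> cycle_mean du dw c)"
proof -
  have sides: "biregular_sides (U n) (W n) du dw" for n
    using assms by unfold_locales auto
  define M where "M n = card (U n) * du" for n
  define P where "P n = random_biregular_bipartite_graph (U n) (W n) du dw" for n
  define counts where "counts E c = (if c \<in> cycle_lengths k then num_cycles c E else 0)"
    for E :: "'a set set" and c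
  define Q where "Q n = map_pmf counts (P n)" for n
  define e where "e n = biregular_sides.approximation_error (U n) du dw k" for n
  have M_eq: "biregular_sides.m (U n) du = M n" for n
    using biregular_sides.m_def[OF sides] by (simp add: M_def)
  have counts_eq: "biregular_sides.cycle_counts k = (counts :: 'a set set \<Rightarrow> _)"
    using biregular_sides.cycle_counts_def[OF sides] by (simp add: counts_def fun_eq_iff)
  let ?coll = "biregular_sides.collisions du dw"
  have M_lim: "filterlim M at_top sequentially"
    unfolding filterlim_at_top
  proof
    fix z
    have "\<forall>\<^sub>F n in sequentially. 2 * z \<le> card (U n \<union> W n)"
      using assms(9) unfolding filterlim_at_top by blast
    then show "\<forall>\<^sub>F n in sequentially. z \<le> M n"
    proof eventually_elim
      case (elim n)
      then show ?case using biregular_sides.card_nodes_le[OF sides, of n] M_eq[of n] by simp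
    qed
  qed
  have real_M: "filterlim (\<lambda>n. real (M n)) at_top sequentially"
    using filterlim_compose[OF filterlim_real_sequentially M_lim] .
  \<comment> \<open>\<open>growth\<close>, \<open>collisions\<close> and \<open>walk_error\<close>
    depend on the degrees and lengths only, so \<open>M n\<close> is all that varies with
    \<open>n\<close>.\<close>
  have e_lim: "e \<longlonglongrightarrow> 0"
  proof -
    have "filterlim (\<lambda>n. real (M n) - a) at_top sequentially" for a
      using filterlim_tendsto_add_at_top[OF tendsto_const[of "- a"] real_M] by simp
    then have "(\<lambda>n. (\<Sum>c\<in>cycle_lengths k. real (biregular_sides.growth du dw c) * (real (?coll c) / (real (M n) - real (?coll c))))
        + real (biregular_sides.walk_error du dw k) / real (M n))
      \<longlonglongrightarrow> (\<Sum>c\<in>cycle_lengths k. real (biregular_sides.growth du dw c) * 0) + 0"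
      by (intro tendsto_intros tendsto_divide_0[OF tendsto_const] filterlim_at_top_imp_at_infinity
          real_M)
    then show ?thesis
      unfolding e_def using biregular_sides.approximation_error_def[OF sides] by (simp add: M_eq)
  qed
  \<comment> \<open>The sum exceeds each single threshold, and \<open>du * dw\<close> makes both
    sides large enough for a graph to exist.\<close>
  let ?K = "max ((\<Sum>j\<le>2 * k + 2. 2 * ?coll j) + 1) (du * dw)"
  have good: "\<forall>\<^sub>F n in sequentially. biregular_bipartite_graphs (U n) (W n) du dw \<noteq> {} \<and>
      (\<forall>j\<le>2 * k + 2. 2 * ?coll j < M n)"
  proof -
    have "\<forall>\<^sub>F n in sequentially. ?K \<le> M n" using M_lim unfolding filterlim_at_top by blast
    then show ?thesis
    proof eventually_elim
      case (elim n)
      have "du * dw \<le> card (U n) * du" "du * dw \<le> card (W n) * dw"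
        using elim assms(8)[of n] by (auto simp: M_def)
      then have "dw \<le> card (U n)" "du \<le> card (W n)"
        using assms(1,2) by (simp_all add: mult.commute)
      then have "biregular_bipartite_graphs (U n) (W n) du dw \<noteq> {}"
        by (rule biregular_sides.graphs_nonempty[OF sides])
      moreover have "2 * ?coll j < M n" if "j \<le> 2 * k + 2" for j
        using elim member_le_sum[of j "{..2 * k + 2}" "\<lambda>j. 2 * ?coll j"] that by simp
      ultimately show ?case by blast
    qed
  qed
  interpret poisson_rates "cycle_lengths k" "cycle_mean du dw"
    using biregular_sides.finite_cycle_lengths[OF sides]
      biregular_sides.cycle_mean_nonneg[OF sides] by unfold_locales
  have supp: "supported x" if "x \<in> set_pmf (Q n)" for n x
    using that by (auto simp: Q_def supported_def counts_def)
  have expectation: "measure_pmf.expectation (Q n) (\<lambda>x. real (x c)) =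
      measure_pmf.expectation (P n) (\<lambda>E. real (num_cycles c E))" if "c \<in> cycle_lengths k" for n c
    using that by (simp add: Q_def counts_def)
  have ev: "\<forall>\<^sub>F n in sequentially. 0 \<le> e n \<and> (\<forall>c\<in>cycle_lengths k.
      integrable (measure_pmf (Q n)) (\<lambda>x. real (x c)) \<and>
      measure_pmf.expectation (Q n) (\<lambda>x. real (x c)) \<le> cycle_mean du dw c + e n \<and>
      (\<forall>x. supported x \<longrightarrow> cycle_mean du dw c * pmf (Q n) x \<le>
        real (Suc (x c)) * pmf (Q n) (x(c := Suc (x c))) + e n))"
    using good
  proof eventually_elim
    case (elim n)
    interpret biregular_sides "U n" "W n" du dw by (rule sides)
    have ne: "graphs \<noteq> {}" and large: "\<forall>j\<le>2 * k + 2. 2 * collisions j < m"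
      using elim by (simp_all add: M_eq)
    \<comment> \<open>Any length would do as a witness for the nonnegativity of the common
      error.\<close>
    have "4 \<in> cycle_lengths k" using assms(4) by (simp add: cycle_lengths_def)
    then have "0 \<le> e n" unfolding e_def by (rule approximation_error_nonneg(3)[OF ne large])
    moreover have "finite (set_pmf (Q n))"
      using ne finite_graphs by (simp add: Q_def P_def random_biregular_bipartite_graph_def)
    then have "integrable (measure_pmf (Q n)) (\<lambda>x. real (x c))" for c
      by (rule integrable_measure_pmf_finite)
    moreover have "measure_pmf.expectation (Q n) (\<lambda>x. real (x c)) \<le> cycle_mean du dw c + e n"
      if "c \<in> cycle_lengths k" for c
      unfolding expectation[OF that] e_def P_def by (rule cycle_counts_mean_le[OF ne large that])
    moreover have "cycle_mean du dw c * pmf (Q n) x \<le>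
        real (Suc (x c)) * pmf (Q n) (x(c := Suc (x c))) + e n"
      if "c \<in> cycle_lengths k" for c x
      using cycle_counts_stein[OF ne large that, of x] unfolding counts_eq e_def Q_def P_def .
    ultimately show ?case by blast
  qed
  have "converges_in_distribution (\<lambda>n. map_pmf (cycle_vector k) (P n))
      (Pi_pmf (cycle_lengths k) 0 (\<lambda>c. map_pmf real (poisson_distribution (cycle_mean du dw c))))"
    unfolding converges_in_distribution_def
  proof (intro allI impI)
    fix f :: "(nat \<Rightarrow> real) \<Rightarrow> real"
    assume "continuous_on UNIV f \<and> bounded (range f)"
    then obtain B where B: "\<And>x. \<bar>f x\<bar> \<le> B" by (auto simp: bounded_iff)
    \<comment> \<open>Composed with \<open>real\<close>, the test function becomes a bounded
      function of integer vectors, for which convergence of the probability of each vector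
      suffices.\<close>
    have "cycle_vector k = (\<lambda>x. real \<circ> x) \<circ> counts"
      by (auto simp: fun_eq_iff cycle_vector_def counts_def)
    then have vec: "map_pmf (cycle_vector k) (P n) = map_pmf (\<lambda>x. real \<circ> x) (Q n)" for n
      by (simp add: Q_def pmf.map_comp)
    have lim: "Pi_pmf (cycle_lengths k) 0 (\<lambda>c. map_pmf real (poisson_distribution (cycle_mean du dw c)))
        = map_pmf (\<lambda>x. real \<circ> x) target"
      by (rule Pi_pmf_map[OF finite_L]) simp
    have "(\<lambda>n. measure_pmf.expectation (Q n) (\<lambda>x. f (real \<circ> x)))
        \<longlonglongrightarrow> measure_pmf.expectation target (\<lambda>x. f (real \<circ> x))"
      using pmf_tendsto_target[OF supp e_lim ev] finite_box prob_box_tendsto[OF set_target] B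
      by (rule expectation_tendsto)
    then show "(\<lambda>n. measure_pmf.expectation (map_pmf (cycle_vector k) (P n)) f) \<longlonglongrightarrow>
        measure_pmf.expectation (Pi_pmf (cycle_lengths k) 0
          (\<lambda>c. map_pmf real (poisson_distribution (cycle_mean du dw c)))) f"
      unfolding vec lim by simp
  qed
  moreover have "(\<lambda>n. measure_pmf.expectation (P n) (\<lambda>E. real (num_cycles c E)))
      \<longlonglongrightarrow> cycle_mean du dw c" if "c \<in> cycle_lengths k" for c
    using expectation_tendsto_rate[OF supp e_lim ev that] by (simp add: expectation[OF that])
  ultimately show ?thesis unfolding P_def by blast
qed

end
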